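(* Let $X$ be an integer-valued random variable with $\mathbb{E}[X]=0$, $\mathbb{P}(X<-1)=0$ and $\mathbb{P}(X\ge x)\sim L(x)/x$ as $x\to\infty$, where $L$ is slowly varying at $\infty$. Let $W_0=0$ and $W_n=X_1+\cdots+X_n$, where $(X_i)_{i\ge1}$ are i.i.d. copies of $X$. Let $\zeta=\inf\{i\ge1: W_i<0\}$ and $T_1=\inf\{j>0: W_j\ge0\}$. There exists an increasing slowly varying function $\Lambda$ such that the following assertions hold. (i) As $n\to\infty$, $$\mathbb{P}(\zeta>n)\sim\frac{L(|b_n|)}{|b_n|}\cdot\Lambda(n)\qquad\text{and}\qquad \mathbb{P}(T_1>n)\sim\frac{1}{\Lambda(n)}.$$ (ii) As $n\to\infty$, $$\sum_{k=0}^{n}\mathbb{P}(\zeta>k)\sim\Lambda(n).$$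
   Context: $(a_n)_{n\ge1}$ and $(b_n)_{n\ge1}$ are sequences such that $n\,\mathbb{P}(X\ge a_n)\to 1$ and $b_n=n\,\mathbb{E}[X\mathbf{1}_{|X|\le a_n}]$ (one has $b_n\to-\infty$). *)

theory Defs
  imports "HOL-Probability.Probability" "HOL-Library.Landau_Symbols" "HOL-Library.Extended_Nat"
begin

text \<open>
  Karamata's definition: positivity and measurability are required only on some
  neighbourhood of infinity, so the values of \<open>f\<close> elsewhere are irrelevant.
\<close>

definition slowly_varying :: "(real \<Rightarrow> real) \<Rightarrow> bool" where
  "slowly_varying f \<longleftrightarrow>
     (\<exists>A. (\<forall>x\<ge>A. 0 < f x) \<and> f \<in> borel_measurable (restrict_space borel {A..})) \<and>
     (\<forall>c>0. ((\<lambda>x. f (c * x) / f x) \<longlongrightarrow> 1) at_top)"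

definition walk :: "(nat \<Rightarrow> 'a \<Rightarrow> int) \<Rightarrow> nat \<Rightarrow> 'a \<Rightarrow> int" where
  "walk Y n \<omega> = (\<Sum>i=1..n. Y i \<omega>)"

text \<open>
  The two hitting times take values in \<^typ>\<open>enat\<close>, so that the infimum of the
  empty set is \<open>\<infinity>\<close>, and such paths belong to the event that the time exceeds \<open>n\<close>.
\<close>

definition first_negative_time :: "(nat \<Rightarrow> 'a \<Rightarrow> int) \<Rightarrow> 'a \<Rightarrow> enat" where
  "first_negative_time W \<omega> = (INF i\<in>{i. 1 \<le> i \<and> W i \<omega> < 0}. enat i)"

definition first_nonneg_time :: "(nat \<Rightarrow> 'a \<Rightarrow> int) \<Rightarrow> 'a \<Rightarrow> enat" where
  "first_nonneg_time W \<omega> = (INF j\<in>{j. 0 < j \<and> 0 \<le> W j \<omega>}. enat j)"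

end

theory Submission
  imports Defs "HOL-Computational_Algebra.Formal_Power_Series" "HOL-Real_Asymp.Real_Asymp"
begin

unbundle fps_syntax and no vec_syntax

text \<open>
  Write \<open>u n\<close> for the probability of \<open>\<zeta> > n\<close>, \<open>v n\<close> for that of \<open>T\<^sub>1 > n\<close>, \<open>p n\<close> for that of
  \<open>W\<^sub>n \<ge> 0\<close>, \<open>U n\<close> for the sum of \<open>u k\<close> over \<open>k \<le> n\<close>, and \<open>T x\<close> for the probability of \<open>X \<ge> x\<close>.

  Everything rests on two convolution identities. Cutting a path at its last maximum gives
  \<open>\<Sum>k\<le>n. u k * v (n - k) = 1\<close> (\<open>stay_duality\<close>). As the walk goes down by steps of size one, it
  satisfies the hitting time theorem, that is, \<open>n\<close> times the probability of \<open>\<zeta> = n\<close> is that of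
  \<open>W\<^sub>n = -1\<close>; together with the decomposition of a path at time \<open>\<zeta>\<close> this yields Spitzer's identity
  \<open>n * u n = (\<Sum>k=1..n. p k * u (n - k))\<close> (\<open>spitzer_identity\<close>).

  The rest is elementary analysis of these identities. Summing Spitzer's identity bounds
  \<open>\<Sum>k\<le>n. k * u k\<close> by \<open>U n * (\<Sum>k=1..n. p k)\<close>. Since \<open>p\<close> tends to 0, this is \<open>o(n) * U n\<close>, so the
  blocks of \<open>U\<close> away from 0 are negligible and \<open>U\<close> is slowly varying (\<open>U_slowly_varying\<close>). The
  duality, \<open>v\<close> being decreasing, then forces \<open>v n * U n\<close> to tend to 1 (\<open>dual_asymp\<close>). If moreover
  \<open>p\<close> is slowly varying, almost all the mass of \<open>u (n - k)\<close> in Spitzer's identity sits at \<open>k\<close> close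
  to \<open>n\<close>, where \<open>p k\<close> is close to \<open>p n\<close>; hence \<open>n * u n \<sim> p n * U n\<close> (\<open>u_asymp\<close>).

  It remains to see that \<open>p n \<sim> n * T \<bar>b n\<bar>\<close> and that the right-hand side is slowly varying. The walk
  drifts to \<open>b n\<close>, whose modulus is \<open>n\<close> times \<open>E[X; X > a n]\<close> because \<open>X\<close> is centred, and returns
  above 0 at time \<open>n\<close> only through a single step of size at least about \<open>\<bar>b n\<bar>\<close>. To make this
  precise, steps are truncated at \<open>\<delta> * \<bar>b n\<bar>\<close>: two larger steps have probability at most
  \<open>(n * T (\<delta> * \<bar>b n\<bar>))\<^sup>2\<close>, and by Chebyshev's inequality the truncated sum is far from its mean with
  probability at most a constant times \<open>\<delta> * n * T \<bar>b n\<bar>\<close>, since the truncated second moment at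
  level \<open>y\<close> is \<open>O(y\<^sup>2 * T y)\<close> (\<open>cut_moment_le\<close>). The level of truncation does not matter for the
  mean: although \<open>\<bar>b n\<bar> / a n\<close> tends to infinity, \<open>E[X; X > y]\<close> is asymptotically the same for
  \<open>y = a n\<close> and \<open>y = \<bar>b n\<bar>\<close> (\<open>tail_mean_drift\<close>).

  For the function \<open>\<Lambda>\<close> one takes \<open>U\<close> at the integer part of \<open>x\<close>, multiplied by \<open>1 - 1 / (2 + x)\<close>
  to make it strictly increasing.
\<close>

section \<open>Sequences satisfying Spitzer's recursion\<close>

lemma cesaro_null:
  fixes p :: "nat \<Rightarrow> real"
  assumes p: "p \<longlonglongrightarrow> 0" and e: "0 < e"
  shows "\<forall>\<^sub>F n in sequentially. (\<Sum>j=1..n. p j) \<le> e * real n"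
proof -
  have "\<forall>\<^sub>F n in sequentially. p n < e / 2"
    using order_tendstoD(2)[OF p, of "e/2"] e by simp
  then obtain N where N: "\<And>n. n \<ge> N \<Longrightarrow> p n < e / 2"
    by (auto simp: eventually_sequentially)
  define S where "S = (\<Sum>j=1..N. \<bar>p j\<bar>)"
  have bound: "(\<Sum>j=1..n. p j) \<le> S + e / 2 * real n" for n
  proof -
    have "(\<Sum>j=1..n. p j) \<le> (\<Sum>j=1..n. (if j \<le> N then \<bar>p j\<bar> else 0) + e / 2)"
      using N e by (intro sum_mono) (auto simp: less_imp_le intro: add_increasing2)
    also have "\<dots> = (\<Sum>j=1..n. if j \<le> N then \<bar>p j\<bar> else 0) + e / 2 * real n"
      by (simp add: sum.distrib)
    also have "(\<Sum>j=1..n. if j \<le> N then \<bar>p j\<bar> else 0) = (\<Sum>j\<in>{j\<in>{1..n}. j \<le> N}. \<bar>p j\<bar>)"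
      by (rule sum.inter_filter[symmetric]) simp
    also have "\<dots> \<le> S" unfolding S_def by (rule sum_mono2) auto
    finally show ?thesis by simp
  qed
  have "\<forall>\<^sub>F n in sequentially. S \<le> e / 2 * real n"
    using e by real_asymp
  then show ?thesis
    by eventually_elim (use bound in \<open>smt (verit) field_sum_of_halves ring_class.ring_distribs\<close>)
qed

text \<open>
  For a random walk, \<open>u n\<close> is the probability of staying nonnegative up to time \<open>n\<close> and \<open>p n\<close> that
  of being nonnegative at time \<open>n\<close>.
\<close>

locale spitzer_sequences =
  fixes u p :: "nat \<Rightarrow> real"
  assumes u_pos: "\<And>n. 0 < u n"
    and u_antimono: "\<And>m n. m \<le> n \<Longrightarrow> u n \<le> u m"
    and p_nonneg: "\<And>n. 0 \<le> p n"
    and p_null: "p \<longlonglongrightarrow> 0"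
    and spitzer: "\<And>n. real n * u n = (\<Sum>k=1..n. p k * u (n - k))"
begin

definition U :: "nat \<Rightarrow> real" where "U n = (\<Sum>k\<le>n. u k)"

lemma U_pos: "0 < U n"
  unfolding U_def by (rule sum_pos) (auto simp: u_pos)

lemma U_mono: "m \<le> n \<Longrightarrow> U m \<le> U n"
  unfolding U_def by (rule sum_mono2) (auto simp: less_imp_le u_pos)

lemma U_diff: "m \<le> n \<Longrightarrow> U n - U m = (\<Sum>k\<in>{m<..n}. u k)"
proof -
  assume mn: "m \<le> n"
  then have "{..n} = {..m} \<union> {m<..n}" by auto
  then have "U n = U m + (\<Sum>k\<in>{m<..n}. u k)"
    unfolding U_def by (subst sum.union_disjoint[symmetric]) auto
  then show ?thesis by simp
qed

lemma weighted_sum_u: "(\<Sum>k\<le>n. real k * u k) = (\<Sum>j=1..n. p j * U (n - j))"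
proof (induction n)
  case (Suc n)
  have "(\<Sum>j=1..Suc n. p j * U (Suc n - j)) =
      (\<Sum>j=1..n. p j * U (n - j) + p j * u (Suc n - j)) + p (Suc n) * u 0"
    by (auto simp: U_def Suc_diff_le algebra_simps intro!: sum.cong)
  also have "\<dots> = (\<Sum>j=1..n. p j * U (n - j)) + (\<Sum>j=1..Suc n. p j * u (Suc n - j))"
    by (simp add: sum.distrib)
  also have "\<dots> = (\<Sum>k\<le>n. real k * u k) + real (Suc n) * u (Suc n)"
    unfolding spitzer[of "Suc n"] Suc.IH ..
  finally show ?case by simp
qed simp

lemma weighted_sum_u_le: "(\<Sum>k\<le>n. real k * u k) \<le> U n * (\<Sum>j=1..n. p j)"
  unfolding weighted_sum_u sum_distrib_left
  by (rule sum_mono) (auto simp: mult.commute[of "U n"] intro!: mult_left_mono U_mono p_nonneg)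

text \<open>
  On the block \<open>{m<..n}\<close> the weight \<open>k\<close> exceeds \<open>m\<close>, so the block of \<open>U\<close> is at most \<open>1 / m\<close> times the
  weighted sum, which is \<open>o(n) * U n\<close> because the averages of \<open>p\<close> tend to 0.
\<close>

lemma U_slowly_varying:
  assumes C: "0 < C" and e: "0 < e"
  shows "\<forall>\<^sub>F n in sequentially. \<forall>m\<le>n. real n \<le> C * real m \<longrightarrow> U n - U m \<le> e * U n"
proof -
  have "\<forall>\<^sub>F n in sequentially. (\<Sum>j=1..n. p j) \<le> e / C * real n"
    using C e by (intro cesaro_null p_null) simp
  moreover have "\<forall>\<^sub>F n :: nat in sequentially. n > 0" by (rule eventually_gt_at_top)
  ultimately show ?thesis
  proof eventually_elim
    case (elim n)
    show ?case
    proof (intro allI impI)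
      fix m assume m: "m \<le> n" "real n \<le> C * real m"
      with elim C have m0: "m > 0" by (cases m) auto
      have "real m * (U n - U m) = (\<Sum>k\<in>{m<..n}. real m * u k)"
        using m by (simp add: U_diff sum_distrib_left)
      also have "\<dots> \<le> (\<Sum>k\<in>{m<..n}. real k * u k)"
        by (intro sum_mono mult_right_mono) (auto simp: less_imp_le u_pos)
      also have "\<dots> \<le> (\<Sum>k\<le>n. real k * u k)"
        by (rule sum_mono2) (auto simp: less_imp_le u_pos)
      also have "\<dots> \<le> U n * (\<Sum>j=1..n. p j)" by (rule weighted_sum_u_le)
      also have "\<dots> \<le> U n * (e / C * real n)"
        using elim U_pos[of n] by (intro mult_left_mono) auto
      also have "\<dots> \<le> U n * (e / C * (C * real m))"
        using m e C U_pos[of n] by (intro mult_left_mono) auto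
      also have "\<dots> = real m * (e * U n)" using C by simp
      finally show "U n - U m \<le> e * U n" using m0 by simp
    qed
  qed
qed

lemma u_negligible:
  assumes e: "0 < e"
  shows "\<forall>\<^sub>F n in sequentially. real n * u n \<le> e * U n"
proof -
  have "\<forall>\<^sub>F n in sequentially. \<forall>m\<le>n. real n \<le> 4 * real m \<longrightarrow> U n - U m \<le> e / 2 * U n"
    using e by (intro U_slowly_varying) auto
  moreover have "\<forall>\<^sub>F n :: nat in sequentially. n > 2" by (rule eventually_gt_at_top)
  ultimately show ?thesis
  proof eventually_elim
    case (elim n)
    define m where "m = n div 2"
    have m: "m \<le> n" "real n \<le> 4 * real m" "real n \<le> 2 * real (n - m)"
      using elim unfolding m_def by linarith+
    have "real (n - m) * u n = (\<Sum>k\<in>{m<..n}. u n)" by simp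
    also have "\<dots> \<le> (\<Sum>k\<in>{m<..n}. u k)" by (rule sum_mono) (auto intro: u_antimono)
    also have "\<dots> = U n - U m" using m by (simp add: U_diff)
    also have "\<dots> \<le> e / 2 * U n" using elim m by blast
    finally have "2 * real (n - m) * u n \<le> e * U n" by simp
    moreover have "real n * u n \<le> 2 * real (n - m) * u n"
      using m u_pos[of n] by (intro mult_right_mono) auto
    ultimately show ?case by linarith
  qed
qed

text \<open>
  The bound \<open>v n * U n \<le> 1\<close> is monotonicity of \<open>v\<close> in the duality relation. For the lower bound the
  relation at time \<open>2 * n\<close> is split at \<open>n\<close>: the first half is at most \<open>v n * U n\<close>, the second at most
  \<open>u n\<close> times the sum of \<open>v\<close>. The latter sum is at most \<open>(2 * n + 1) / U n\<close>, by adding up the duality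
  relations for all times up to \<open>2 * n\<close>, and \<open>n * u n\<close> is negligible compared with \<open>U n\<close>.
\<close>

lemma dual_asymp:
  fixes v :: "nat \<Rightarrow> real"
  assumes v_nonneg: "\<And>n. 0 \<le> v n" and v_antimono: "\<And>m n. m \<le> n \<Longrightarrow> v n \<le> v m"
    and dual: "\<And>n. (\<Sum>k\<le>n. u k * v (n - k)) = 1"
  shows "(\<lambda>n. v n * U n) \<longlonglongrightarrow> 1"
proof (rule tendstoI)
  fix e :: real assume e: "0 < e"
  have upper: "v n * U n \<le> 1" for n
  proof -
    have "v n * U n = (\<Sum>k\<le>n. u k * v n)" unfolding U_def by (simp add: sum_distrib_left mult.commute)
    also have "\<dots> \<le> (\<Sum>k\<le>n. u k * v (n - k))"
      by (intro sum_mono mult_left_mono v_antimono) (auto simp: less_imp_le u_pos)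
    finally show ?thesis by (simp add: dual)
  qed
  have UV: "U n * (\<Sum>i\<le>n. v i) \<le> 2 * real n + 1" for n
  proof -
    have "U n * (\<Sum>i\<le>n. v i) = (\<Sum>(k,i)\<in>{..n} \<times> {..n}. u k * v i)"
      unfolding U_def by (simp add: sum_product sum.cartesian_product)
    also have "\<dots> \<le> (\<Sum>(k,i)\<in>(\<lambda>(m,k). (k, m - k)) ` (SIGMA m:{..2*n}. {..m}). u k * v i)"
    proof (rule sum_mono2)
      show "{..n} \<times> {..n} \<subseteq> (\<lambda>(m,k). (k, m - k)) ` (SIGMA m:{..2*n}. {..m})"
      proof
        fix z assume "z \<in> {..n} \<times> {..n}"
        then obtain k i where "z = (k, i)" "k \<le> n" "i \<le> n" by auto
        then have "z = (\<lambda>(m,k). (k, m - k)) (k + i, k)" "(k + i, k) \<in> (SIGMA m:{..2*n}. {..m})" by auto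
        then show "z \<in> (\<lambda>(m,k). (k, m - k)) ` (SIGMA m:{..2*n}. {..m})" by blast
      qed
    qed (auto simp: less_imp_le u_pos v_nonneg)
    also have "\<dots> = (\<Sum>(m,k)\<in>(SIGMA m:{..2*n}. {..m}). u k * v (m - k))"
      by (subst sum.reindex) (auto simp: inj_on_def case_prod_unfold)
    also have "\<dots> = (\<Sum>m\<le>2*n. \<Sum>k\<le>m. u k * v (m - k))" by (simp add: sum.Sigma)
    also have "\<dots> = 2 * real n + 1" by (simp add: dual)
    finally show ?thesis .
  qed
  have lower: "1 \<le> v m * U m + u m * (\<Sum>i\<le>m. v i)" for m
  proof -
    have "1 = (\<Sum>k\<le>m + m. u k * v (m + m - k))" by (simp add: dual)
    also have "{..m+m} = {..m} \<union> {m<..m+m}" by auto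
    also have "(\<Sum>k\<in>{..m} \<union> {m<..m+m}. u k * v (m + m - k)) =
        (\<Sum>k\<le>m. u k * v (m + m - k)) + (\<Sum>k\<in>{m<..m+m}. u k * v (m + m - k))"
      by (rule sum.union_disjoint) auto
    also have "(\<Sum>k\<le>m. u k * v (m + m - k)) \<le> (\<Sum>k\<le>m. u k * v m)"
      by (intro sum_mono mult_left_mono v_antimono) (auto simp: less_imp_le u_pos)
    also have "\<dots> = v m * U m" unfolding U_def by (simp add: sum_distrib_left mult.commute)
    also have "(\<Sum>k\<in>{m<..m+m}. u k * v (m + m - k)) \<le> (\<Sum>k\<in>{m<..m+m}. u m * v (m + m - k))"
      by (intro sum_mono mult_right_mono u_antimono) (auto simp: v_nonneg)
    also have "\<dots> = u m * (\<Sum>i<m. v i)"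
      unfolding sum_distrib_left
      by (rule sum.reindex_bij_witness[of _ "\<lambda>i. m + m - i" "\<lambda>k. m + m - k"]) auto
    also have "\<dots> \<le> u m * (\<Sum>i\<le>m. v i)"
      using u_pos[of m] by (intro mult_left_mono sum_mono2) (auto simp: v_nonneg)
    finally show ?thesis by simp
  qed
  have "\<forall>\<^sub>F n in sequentially. real n * u n \<le> e / 4 * U n"
    using e by (intro u_negligible) simp
  moreover have "\<forall>\<^sub>F n :: nat in sequentially. n > 0" by (rule eventually_gt_at_top)
  ultimately show "\<forall>\<^sub>F n in sequentially. dist (v n * U n) 1 < e"
  proof eventually_elim
    case (elim n)
    let ?V = "\<Sum>i\<le>n. v i"
    have "real n * (u n * ?V) \<le> e / 4 * U n * ?V"
      using mult_right_mono[OF elim(1), of ?V] by (simp add: sum_nonneg v_nonneg mult.assoc)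
    also have "\<dots> \<le> e / 4 * (2 * real n + 1)"
      using UV[of n] e by (simp add: mult.assoc)
    also have "\<dots> \<le> real n * (3 / 4 * e)"
      using elim(2) e by (auto simp: field_simps)
    finally have "u n * ?V \<le> 3 / 4 * e" using elim(2) by simp
    with lower[of n] upper[of n] e show ?case by (auto simp: dist_real_def abs_if)
  qed
qed

text \<open>
  Going from \<open>n\<close> to about \<open>n / 2\<close> changes \<open>p\<close> by a factor at most \<open>3 / 2 < 2\<close>, so the contributions
  of the dyadic blocks decrease geometrically.
\<close>

lemma sum_p_le:
  assumes unif: "\<forall>\<^sub>F n in sequentially. 0 < p n \<and> (\<forall>k\<le>n. n \<le> 2 * k \<longrightarrow> \<bar>p k - p n\<bar> \<le> p n / 2)"
  shows "\<exists>C>0. \<forall>\<^sub>F n in sequentially. (\<Sum>k=1..n. p k) \<le> C * (real n * p n)"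
proof -
  obtain N where N: "\<And>n. n \<ge> N \<Longrightarrow> 0 < p n"
    "\<And>n k. n \<ge> N \<Longrightarrow> k \<le> n \<Longrightarrow> n \<le> 2 * k \<Longrightarrow> \<bar>p k - p n\<bar> \<le> p n / 2"
    using unif unfolding eventually_sequentially by blast
  define M where "M = N + 3"
  define C where "C = 12 + (\<Sum>n\<in>{M..2*M}. (\<Sum>k=1..n. p k) / (real n * p n))"
  have terms: "0 \<le> (\<Sum>k=1..n. p k) / (real n * p n)" for n
    by (intro divide_nonneg_nonneg sum_nonneg mult_nonneg_nonneg p_nonneg) auto
  have C12: "12 \<le> C" unfolding C_def using terms by (simp add: sum_nonneg)
  have main: "(\<Sum>k=1..n. p k) \<le> C * (real n * p n)" if "n \<ge> M" for n
    using that
  proof (induction n rule: less_induct)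
    case (less n)
    have pn: "0 < p n" and n0: "n > 0" using less.prems N unfolding M_def by auto
    show ?case
    proof (cases "n \<le> 2 * M")
      case True
      then have "(\<Sum>k=1..n. p k) / (real n * p n) \<le> (\<Sum>n\<in>{M..2*M}. (\<Sum>k=1..n. p k) / (real n * p n))"
        using less.prems terms by (intro member_le_sum) auto
      also have "\<dots> \<le> C" unfolding C_def by simp
      finally show ?thesis using pn n0 by (simp add: pos_divide_le_eq)
    next
      case False
      \<comment> \<open>rounding up keeps \<open>n \<le> 2 * m\<close>; for \<open>n > 6\<close> still \<open>m \<le> 7 / 12 * n\<close>, and \<open>3 / 2 * 7 / 12 < 1\<close>\<close>
      define m where "m = (n + 1) div 2"
      have m: "m < n" "m \<ge> M" "n \<le> 2 * m" "2 * m \<le> n + 1" using False unfolding m_def M_def by auto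
      have nN: "n \<ge> N" using less.prems unfolding M_def by simp
      have near: "p k \<le> 3/2 * p n" if "m \<le> k" "k \<le> n" for k
      proof -
        have "n \<le> 2 * k" using that m by linarith
        from N(2)[OF nN that(2) this] show ?thesis by linarith
      qed
      have "{1..n} = {1..m} \<union> {m<..n}" using m unfolding M_def by auto
      then have "(\<Sum>k=1..n. p k) = (\<Sum>k=1..m. p k) + (\<Sum>k\<in>{m<..n}. p k)"
        by (simp only:) (rule sum.union_disjoint, auto)
      also have "(\<Sum>k\<in>{m<..n}. p k) \<le> (\<Sum>k\<in>{m<..n}. 3/2 * p n)"
        using near by (intro sum_mono) auto
      also have "\<dots> = real (n - m) * (3/2 * p n)" by simp
      also have "\<dots> \<le> real n * (3/2 * p n)" using pn by (intro mult_right_mono) auto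
      also have "(\<Sum>k=1..m. p k) \<le> C * (real m * p m)" by (rule less.IH[OF m(1,2)])
      also have "\<dots> \<le> C * (real m * (3/2 * p n))"
        using near[of m] m C12 by (intro mult_left_mono) auto
      also have "\<dots> \<le> C * ((7/12 * real n) * (3/2 * p n))"
      proof -
        have "n > 6" using False unfolding M_def by simp
        then have "12 * m \<le> 7 * n" using m(4) by presburger
        then have "real (12 * m) \<le> real (7 * n)" by (simp only: of_nat_le_iff)
        then have "real m \<le> 7/12 * real n" by simp
        then show ?thesis using C12 pn by (intro mult_left_mono mult_right_mono) auto
      qed
      finally have "(\<Sum>k=1..n. p k) \<le> (7/8 * C + 3/2) * (real n * p n)"
        by (simp add: algebra_simps)
      also have "\<dots> \<le> C * (real n * p n)"
        using C12 pn by (intro mult_right_mono) auto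
      finally show ?thesis .
    qed
  qed
  show ?thesis
    using C12 main by (intro exI[of _ C]) (auto simp: eventually_sequentially)
qed

text \<open>
  Spitzer's sum is split at \<open>n div 2\<close>. For large \<open>k\<close> the factor \<open>p k\<close> is almost \<open>p n\<close> and the remaining
  sum of \<open>u\<close> is almost \<open>U n\<close> by slow variation. For small \<open>k\<close> the factor \<open>u (n - k)\<close> is at most
  \<open>u (n div 2)\<close>, which is \<open>o(U n / n)\<close>, while \<open>p\<close> sums up to \<open>O(n * p n)\<close>.
\<close>

lemma u_asymp:
  assumes unif: "\<And>e. 0 < e \<Longrightarrow>
     \<forall>\<^sub>F n in sequentially. 0 < p n \<and> (\<forall>k\<le>n. n \<le> 2 * k \<longrightarrow> \<bar>p k - p n\<bar> \<le> e * p n)"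
  shows "(\<lambda>n. real n * u n / (p n * U n)) \<longlonglongrightarrow> 1"
proof (rule tendstoI)
  fix e :: real assume e: "0 < e"
  obtain C where C: "C > 0" and sump: "\<forall>\<^sub>F n in sequentially. (\<Sum>k=1..n. p k) \<le> C * (real n * p n)"
    using sum_p_le unif[of "1/2"] by auto
  define d where "d = min (e / 4) 1"
  have d: "d > 0" "d \<le> 1" "d \<le> e / 4" using e unfolding d_def by auto
  define h :: "nat \<Rightarrow> nat" where "h n = n div 2" for n
  have h_top: "filterlim h at_top sequentially"
    unfolding filterlim_at_top eventually_sequentially h_def
    by (metis div_le_mono nonzero_mult_div_cancel_left zero_neq_numeral)
  have "\<forall>\<^sub>F n in sequentially. real (h n) * u (h n) \<le> d / (3 * C) * U (h n)"
    by (rule eventually_compose_filterlim[OF u_negligible h_top]) (use d C in auto)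
  moreover have "\<forall>\<^sub>F n in sequentially. \<forall>m\<le>n. real n \<le> 4 * real m \<longrightarrow> U n - U m \<le> d * U n"
    using d by (intro U_slowly_varying) auto
  moreover have "\<forall>\<^sub>F n in sequentially. 0 < p n \<and> (\<forall>k\<le>n. n \<le> 2 * k \<longrightarrow> \<bar>p k - p n\<bar> \<le> d * p n)"
    using d by (intro unif) auto
  moreover have "\<forall>\<^sub>F n :: nat in sequentially. n > 4" by (rule eventually_gt_at_top)
  ultimately show "\<forall>\<^sub>F n in sequentially. dist (real n * u n / (p n * U n)) 1 < e"
    using sump
  proof eventually_elim
    case (elim n)
    define m where "m = h n"
    have m: "m \<le> n" "2 * m \<le> n" "n \<le> 2 * m + 1"
      unfolding m_def h_def by presburger+
    then have m': "real n \<le> 3 * real m" "m \<ge> 1" using elim(4) by linarith+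
    note m = m m' 
    have pn: "0 < p n" using elim by blast
    define D where "D = p n * U n"
    have D: "D > 0" unfolding D_def using pn U_pos by simp
    define q where "q = n - Suc m"
    have "n \<le> 4 * q" using m(2) elim(4) unfolding q_def by linarith
    then have q: "real n \<le> 4 * real q" "q \<le> n" unfolding q_def by linarith+
    have near: "\<bar>p k - p n\<bar> \<le> d * p n" if "k \<in> {m<..n}" for k
      using elim(3) that m by auto
    have split: "real n * u n = (\<Sum>k=1..m. p k * u (n - k)) + (\<Sum>k\<in>{m<..n}. p k * u (n - k))"
    proof -
      have "{1..n} = {1..m} \<union> {m<..n}" using m by auto
      then show ?thesis unfolding spitzer by (simp only:) (rule sum.union_disjoint, auto)
    qed
    have reindex: "(\<Sum>k\<in>{m<..n}. u (n - k)) = U q"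
      unfolding U_def by (rule sum.reindex_bij_witness[of _ "\<lambda>i. n - i" "\<lambda>k. n - k"])
        (use m elim(4) in \<open>auto simp: q_def\<close>)
    have "(\<Sum>k=1..m. p k * u (n - k)) \<le> (\<Sum>k=1..m. p k * u m)"
      using m by (intro sum_mono mult_left_mono u_antimono p_nonneg) auto
    also have "\<dots> = u m * (\<Sum>k=1..m. p k)" by (simp add: sum_distrib_left mult.commute)
    also have "\<dots> \<le> u m * (\<Sum>k=1..n. p k)"
      using m u_pos[of m] by (intro mult_left_mono sum_mono2) (auto simp: p_nonneg)
    also have "\<dots> \<le> u m * (C * (real n * p n))"
      using elim u_pos[of m] by (intro mult_left_mono) auto
    also have "\<dots> \<le> u m * (C * ((3 * real m) * p n))"
      using m u_pos[of m] pn C by (intro mult_left_mono mult_right_mono) auto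
    also have "\<dots> = 3 * C * p n * (real m * u m)" by simp
    also have "\<dots> \<le> 3 * C * p n * (d / (3 * C) * U m)"
      using elim(1) C pn unfolding m_def by (intro mult_left_mono) auto
    also have "\<dots> = d * p n * U m" using C by simp
    also have "\<dots> \<le> d * p n * U n" using d pn m by (intro mult_left_mono U_mono) auto
    finally have small: "(\<Sum>k=1..m. p k * u (n - k)) \<le> d * D" by (simp add: D_def)
    have small0: "0 \<le> (\<Sum>k=1..m. p k * u (n - k))"
      by (intro sum_nonneg mult_nonneg_nonneg p_nonneg) (auto simp: less_imp_le u_pos)
    have "(\<Sum>k\<in>{m<..n}. p k * u (n - k)) \<le> (\<Sum>k\<in>{m<..n}. (1 + d) * p n * u (n - k))"
      using near by (intro sum_mono mult_right_mono) (auto simp: less_imp_le u_pos algebra_simps abs_le_iff)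
    also have "\<dots> = (1 + d) * p n * U q" by (simp add: reindex flip: sum_distrib_left)
    also have "\<dots> \<le> (1 + d) * p n * U n" using d pn q by (intro mult_left_mono U_mono) auto
    finally have up: "(\<Sum>k\<in>{m<..n}. p k * u (n - k)) \<le> (1 + d) * D" by (simp add: D_def)
    have "(1 - d) * D \<le> p n * U q"
    proof -
      have "(1 - d) * U n \<le> U q" using elim(2) q by (auto simp: algebra_simps)
      then show ?thesis using mult_left_mono[of "(1-d) * U n" "U q" "p n"] pn by (simp add: D_def mult_ac)
    qed
    then have "(1 - d) * ((1 - d) * D) \<le> (1 - d) * (p n * U q)" using d by (intro mult_left_mono) auto
    also have "\<dots> = (\<Sum>k\<in>{m<..n}. (1 - d) * p n * u (n - k))"
      by (simp add: reindex flip: sum_distrib_left)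
    also have "\<dots> \<le> (\<Sum>k\<in>{m<..n}. p k * u (n - k))"
      using near by (intro sum_mono mult_right_mono) (auto simp: less_imp_le u_pos algebra_simps abs_le_iff)
    finally have low: "(1 - d) * ((1 - d) * D) \<le> (\<Sum>k\<in>{m<..n}. p k * u (n - k))" .
    have "real n * u n \<le> (1 + 2 * d) * D" using split small up by (simp add: algebra_simps)
    then have 1: "real n * u n / D \<le> 1 + 2 * d" using D by (simp add: pos_divide_le_eq)
    have "(1 - 2 * d) * D \<le> (1 - d) * ((1 - d) * D)" using D by (simp add: algebra_simps)
    then have "(1 - 2 * d) * D \<le> real n * u n" using split small0 low by linarith
    then have 2: "1 - 2 * d \<le> real n * u n / D" using D by (simp add: pos_le_divide_eq)
    show ?case using 1 2 d e unfolding D_def[symmetric] dist_real_def by (auto simp: abs_if)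
  qed
qed

text \<open>
  The step function \<open>U\<close> is made strictly increasing by a factor that increases to 1.
\<close>

definition Lam :: "real \<Rightarrow> real" where
  "Lam x = U (nat \<lfloor>x\<rfloor>) * (1 - 1 / (2 + x))"

lemma Lam_strict_mono: "strict_mono_on {0..} Lam"
proof (rule strict_mono_onI)
  fix x y :: real assume xy: "x \<in> {0..}" "y \<in> {0..}" "x < y"
  have "U (nat \<lfloor>x\<rfloor>) * (1 - 1 / (2 + x)) < U (nat \<lfloor>x\<rfloor>) * (1 - 1 / (2 + y))"
    using xy U_pos by (intro mult_strict_left_mono diff_strict_left_mono divide_strict_left_mono) auto
  also have "\<dots> \<le> U (nat \<lfloor>y\<rfloor>) * (1 - 1 / (2 + y))"
    using xy by (intro mult_right_mono U_mono nat_mono floor_mono) (auto simp: field_simps)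
  finally show "Lam x < Lam y" unfolding Lam_def .
qed

text \<open>
  The integers below \<open>x\<close> and \<open>c * x\<close> are comparable up to a constant, so the bound on the blocks of
  \<open>U\<close> applies to whichever of them is the larger.
\<close>

lemma U_floor_ratio:
  fixes c :: real
  assumes c: "0 < c"
  shows "((\<lambda>x. U (nat \<lfloor>c * x\<rfloor>) / U (nat \<lfloor>x\<rfloor>)) \<longlongrightarrow> 1) at_top"
proof (rule tendstoI)
  fix e :: real assume e: "0 < e"
  define d where "d = min (e / 4) (1 / 2)"
  have d: "0 < d" "d \<le> 1/2" "4 * d \<le> e" using e unfolding d_def by auto
  \<comment> \<open>the factor 2 absorbs the rounding in the integer parts\<close>
  define C where "C = 2 * (c + 1 / c)"
  have "0 < 2 * c" "0 < 2 / c" using c by simp_all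
  moreover have "C = 2 * c + 2 / c" unfolding C_def by (simp add: distrib_left)
  ultimately have "0 < C" "2 * c \<le> C" "2 / c \<le> C" by linarith+
  then have C: "0 < C" "2 * c \<le> C" "2 \<le> C * c" using c by (auto simp: pos_divide_le_eq)
  obtain N where N: "\<And>n m. N \<le> n \<Longrightarrow> m \<le> n \<Longrightarrow> real n \<le> C * real m \<Longrightarrow> U n - U m \<le> d * U n"
    using U_slowly_varying[OF C(1) d(1)] unfolding eventually_sequentially by blast
  have "\<forall>\<^sub>F x :: real in at_top. x \<ge> real N + 1 + C + C / c"
    by (rule eventually_ge_at_top)
  then show "\<forall>\<^sub>F x in at_top. dist (U (nat \<lfloor>c * x\<rfloor>) / U (nat \<lfloor>x\<rfloor>)) 1 < e"
  proof eventually_elim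
    case (elim x)
    define n where "n = nat \<lfloor>x\<rfloor>"
    define m where "m = nat \<lfloor>c * x\<rfloor>"
    have Cc: "0 < C / c" using C c by simp
    have x: "0 \<le> x" "C \<le> x" "C / c \<le> x" "real N + 1 \<le> x" using elim C(1) Cc by linarith+
    have cx: "0 \<le> c * x" using x c by simp
    have n: "real n \<le> x" "x - 1 \<le> real n" unfolding n_def using x by linarith+
    have m: "real m \<le> c * x" "c * x - 1 \<le> real m" unfolding m_def using cx by linarith+
    have nN: "N \<le> n" using n x by linarith
    have n1: "real n \<le> C * real m"
    proof -
      have "real n \<le> 2 * x - C" using n x by linarith
      also have "2 * x \<le> (C * c) * x" using C x by (intro mult_right_mono) auto
      also have "(C * c) * x - C = C * (c * x - 1)" by (simp add: algebra_simps)
      also have "\<dots> \<le> C * real m" using m C by (intro mult_left_mono) auto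
      finally show ?thesis by simp
    qed
    have n2: "real m \<le> C * real n"
    proof -
      have "C \<le> c * x" using x(3) c by (simp add: pos_divide_le_eq mult.commute)
      then have "real m \<le> 2 * c * x - C" using m by linarith
      also have "2 * c * x \<le> C * x" using C x by (intro mult_right_mono) auto
      also have "C * x - C = C * (x - 1)" by (simp add: algebra_simps)
      also have "\<dots> \<le> C * real n" using n C by (intro mult_left_mono) auto
      finally show ?thesis by simp
    qed
    have Un: "0 < U n" "0 < U m" by (rule U_pos)+
    have "\<bar>U m - U n\<bar> \<le> 2 * d * U n"
    proof (cases "m \<le> n")
      case True
      then have "U n - U m \<le> d * U n" "U m \<le> U n" using N[OF nN True n1] U_mono by auto
      moreover have "0 \<le> d * U n" using d Un by simp
      ultimately show ?thesis by linarith
    next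
      case False
      then have nm: "N \<le> m" "n \<le> m" using nN by auto
      have 1: "U m - U n \<le> d * U m" "U n \<le> U m" using N[OF nm n2] U_mono[OF nm(2)] by auto
      have "d * U m \<le> 1/2 * U m" using d Un by (intro mult_right_mono) auto
      then have "U m \<le> 2 * U n" using 1 by linarith
      then have "d * U m \<le> d * (2 * U n)" using d by (intro mult_left_mono) auto
      then show ?thesis using 1 by simp
    qed
    then have "\<bar>U m - U n\<bar> / U n \<le> 2 * d" using Un by (simp add: pos_divide_le_eq)
    moreover have "\<bar>U m / U n - 1\<bar> = \<bar>U m - U n\<bar> / U n"
    proof -
      have "U m / U n - 1 = (U m - U n) / U n" using Un by (simp add: field_simps)
      then show ?thesis using Un by simp
    qed
    ultimately show ?case using d e unfolding n_def m_def dist_real_def by linarith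
  qed
qed

lemma Lam_slowly_varying: "slowly_varying Lam"
  unfolding slowly_varying_def
proof (intro conjI exI[of _ 0] allI impI)
  fix x :: real assume "0 \<le> x"
  then show "0 < Lam x" unfolding Lam_def using U_pos by (intro mult_pos_pos) (auto simp: field_simps)
next
  show "Lam \<in> borel_measurable (restrict_space borel {0..})"
    unfolding Lam_def[abs_def] by (intro measurable_restrict_space1) measurable
next
  fix c :: real assume c: "0 < c"
  have "((\<lambda>x. (1 - 1 / (2 + c * x)) / (1 - 1 / (2 + x))) \<longlongrightarrow> 1) at_top"
    using c by real_asymp
  from tendsto_mult[OF U_floor_ratio[OF c] this]
  show "((\<lambda>x. Lam (c * x) / Lam x) \<longlongrightarrow> 1) at_top"
    unfolding Lam_def by simp
qed

lemma Lam_asymp: "(\<lambda>n. Lam (real n) / U n) \<longlonglongrightarrow> 1"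
proof -
  have "(\<lambda>n. 1 - 1 / (2 + real n)) \<longlonglongrightarrow> 1" by real_asymp
  then show ?thesis unfolding Lam_def using U_pos by (simp add: less_imp_neq[symmetric])
qed

end

section \<open>Finite i.i.d. sequences as lists\<close>

lemma replicate_pmf_Suc_pair:
  "replicate_pmf (Suc n) p = map_pmf (\<lambda>(x, xs). x # xs) (pair_pmf p (replicate_pmf n p))"
  by (simp add: pair_pmf_def map_bind_pmf map_pmf_def bind_assoc_pmf bind_return_pmf)

lemma replicate_pmf_append:
  "replicate_pmf (m + n) p =
     map_pmf (\<lambda>(xs, ys). xs @ ys) (pair_pmf (replicate_pmf m p) (replicate_pmf n p))"
  by (simp add: replicate_pmf_distrib pair_pmf_def map_bind_pmf map_pmf_def bind_assoc_pmf bind_return_pmf)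

lemma length_replicate_pmf: "xs \<in> set_pmf (replicate_pmf n p) \<Longrightarrow> length xs = n"
  by (simp add: set_replicate_pmf)

lemma prob_take_drop:
  fixes p :: "'a :: countable pmf"
  assumes "k \<le> n"
  shows "measure_pmf.prob (replicate_pmf n p) {xs. A (take k xs) \<and> B (drop k xs)} =
    measure_pmf.prob (replicate_pmf k p) {xs. A xs} * measure_pmf.prob (replicate_pmf (n - k) p) {xs. B xs}"
proof -
  let ?P = "pair_pmf (replicate_pmf k p) (replicate_pmf (n - k) p)"
  have "measure_pmf.prob (replicate_pmf n p) {xs. A (take k xs) \<and> B (drop k xs)} =
      measure_pmf.prob ?P {z. A (take k (fst z @ snd z)) \<and> B (drop k (fst z @ snd z))}"
    using replicate_pmf_append[of k "n - k" p] assms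
    by (simp add: vimage_def case_prod_unfold)
  also have "\<dots> = measure_pmf.prob ?P ({xs. A xs} \<times> {xs. B xs})"
    by (rule measure_pmf.finite_measure_eq_AE) (auto simp: AE_measure_pmf_iff length_replicate_pmf)
  also have "\<dots> = measure_pmf.prob (replicate_pmf k p) {xs. A xs} *
      measure_pmf.prob (replicate_pmf (n - k) p) {xs. B xs}"
    by (rule measure_pmf_prob_product) auto
  finally show ?thesis .
qed

lemma pmf_replicate:
  "pmf (replicate_pmf n p) xs = (if length xs = n then (\<Prod>x\<leftarrow>xs. pmf p x) else 0)"
proof (induction n arbitrary: xs)
  case 0
  then show ?case by (auto simp: indicator_def)
next
  case (Suc n)
  show ?case
  proof (cases xs)
    case Nil
    then show ?thesis by (auto simp: pmf_eq_0_set_pmf replicate_pmf_Suc_pair simp del: replicate_pmf.simps)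
  next
    case (Cons y ys)
    have inj: "inj (\<lambda>(x::'a, xs). x # xs)" by (auto simp: inj_def)
    have "pmf (replicate_pmf (Suc n) p) (y # ys) = pmf (pair_pmf p (replicate_pmf n p)) (y, ys)"
      unfolding replicate_pmf_Suc_pair using pmf_map_inj'[OF inj, of _ "(y, ys)"] by simp
    then show ?thesis using Suc.IH Cons by (simp add: pmf_pair)
  qed
qed

text \<open>
  The point masses are products over the entries, which do not depend on the order of the list.
\<close>

lemma map_rev_replicate_pmf: "map_pmf rev (replicate_pmf n p) = replicate_pmf n p"
proof (rule pmf_eqI)
  fix xs
  have "pmf (map_pmf rev (replicate_pmf n p)) (rev (rev xs)) = pmf (replicate_pmf n p) (rev xs)"
    by (rule pmf_map_inj') (simp add: inj_def)
  then show "pmf (map_pmf rev (replicate_pmf n p)) xs = pmf (replicate_pmf n p) xs"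
    by (simp add: pmf_replicate prod_list.rev rev_map[symmetric])
qed

lemma map_rotate1_replicate_pmf: "map_pmf rotate1 (replicate_pmf n p) = replicate_pmf n p"
proof (rule pmf_eqI)
  fix xs :: "'a list"
  obtain ys where ys: "xs = rotate1 ys"
    by (cases xs rule: rev_cases) (auto intro: that[of "[]"], metis rotate1.simps(2) that)
  have "pmf (map_pmf rotate1 (replicate_pmf n p)) (rotate1 ys) = pmf (replicate_pmf n p) ys"
    by (rule pmf_map_inj') (simp add: inj_rotate1)
  then show "pmf (map_pmf rotate1 (replicate_pmf n p)) xs = pmf (replicate_pmf n p) xs"
    by (cases ys) (simp_all add: ys pmf_replicate mult.commute)
qed

lemma map_rotate_replicate_pmf: "map_pmf (rotate k) (replicate_pmf n p) = replicate_pmf n p"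
proof (induction k)
  case (Suc k)
  have "rotate (Suc k) = (rotate1 \<circ> rotate k :: 'a list \<Rightarrow> 'a list)" by (auto simp: rotate_def)
  then show ?case
    by (simp only: pmf.map_comp[symmetric] Suc.IH map_rotate1_replicate_pmf)
qed (simp add: rotate_def pmf.map_id0 id_def[symmetric])

text \<open>
  A union bound over positions: when the side condition \<open>G\<close> is invariant under rotation, every
  position can be moved to the head of the list.
\<close>

lemma prob_exists_le:
  fixes G :: "'a list \<Rightarrow> bool"
  assumes G: "\<And>xs. G (rotate1 xs) \<longleftrightarrow> G xs"
  shows "measure_pmf.prob (replicate_pmf n p) {xs. (\<exists>x\<in>set xs. A x) \<and> G xs} \<le>
    real n * measure_pmf.prob (replicate_pmf n p) {xs. A (hd xs) \<and> G xs}"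
proof -
  let ?P = "measure_pmf.prob (replicate_pmf n p)"
  have Grot: "G (rotate k xs) \<longleftrightarrow> G xs" for k xs
    by (induction k) (simp_all add: G rotate_def)
  have each: "?P {xs. A (xs ! i) \<and> G xs} = ?P {xs. A (hd xs) \<and> G xs}" if "i < n" for i
  proof -
    have "?P {xs. A (hd xs) \<and> G xs} = measure_pmf.prob (map_pmf (rotate i) (replicate_pmf n p)) {xs. A (hd xs) \<and> G xs}"
      by (simp add: map_rotate_replicate_pmf)
    also have "\<dots> = ?P {xs. A (hd (rotate i xs)) \<and> G xs}"
      by (simp add: vimage_def Grot)
    also have "\<dots> = ?P {xs. A (xs ! i) \<and> G xs}"
    proof (rule measure_pmf.finite_measure_eq_AE)
      have "hd (rotate i xs) = xs ! i" if "xs \<in> set_pmf (replicate_pmf n p)" for xs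
        using length_replicate_pmf[OF that] \<open>i < n\<close> by (subst hd_rotate_conv_nth) auto
      then show "AE xs in replicate_pmf n p. xs \<in> {xs. A (hd (rotate i xs)) \<and> G xs} \<longleftrightarrow>
          xs \<in> {xs. A (xs ! i) \<and> G xs}"
        by (simp add: AE_measure_pmf_iff)
    qed auto
    finally show ?thesis by simp
  qed
  have "?P {xs. (\<exists>x\<in>set xs. A x) \<and> G xs} \<le> ?P (\<Union>i<n. {xs. A (xs ! i) \<and> G xs})"
    by (rule measure_pmf.finite_measure_mono_AE)
      (auto simp: AE_measure_pmf_iff in_set_conv_nth dest!: length_replicate_pmf)
  also have "\<dots> \<le> (\<Sum>i<n. ?P {xs. A (xs ! i) \<and> G xs})"
    by (rule measure_pmf.finite_measure_subadditive_finite) auto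
  also have "\<dots> = real n * ?P {xs. A (hd xs) \<and> G xs}" using each by simp
  finally show ?thesis .
qed

definition psum :: "int list \<Rightarrow> nat \<Rightarrow> int" where
  "psum xs i = sum_list (take i xs)"

lemma psum_0 [simp]: "psum xs 0 = 0" by (simp add: psum_def)
lemma psum_length [simp]: "length xs \<le> i \<Longrightarrow> psum xs i = sum_list xs" by (simp add: psum_def)
lemma psum_Cons_Suc [simp]: "psum (x # xs) (Suc i) = x + psum xs i" by (simp add: psum_def)
lemma psum_take: "i \<le> k \<Longrightarrow> psum (take k xs) i = psum xs i" by (simp add: psum_def min_def)
lemma psum_drop: "psum (drop k xs) i = psum xs (k + i) - psum xs k"
  by (simp add: psum_def take_add)
lemma psum_rev: "i \<le> length xs \<Longrightarrow> psum (rev xs) i = sum_list xs - psum xs (length xs - i)"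
proof -
  assume "i \<le> length xs"
  have "sum_list xs = sum_list (take (length xs - i) xs) + sum_list (drop (length xs - i) xs)"
    by (metis append_take_drop_id sum_list_append)
  then show ?thesis
    by (simp add: psum_def take_rev sum_list_rev)
qed

lemma sum_list_ge: "(\<And>x. x \<in> set xs \<Longrightarrow> -1 \<le> x) \<Longrightarrow> - int (length xs) \<le> sum_list xs"
  by (induction xs) force+

lemma psum_Suc: "i < length xs \<Longrightarrow> psum xs (Suc i) = psum xs i + xs ! i"
  by (simp add: psum_def take_Suc_conv_app_nth)

lemma last_argmax:
  fixes s :: "nat \<Rightarrow> int"
  shows "\<exists>k\<le>n. (\<forall>j\<le>k. s j \<le> s k) \<and> (\<forall>j. k < j \<and> j \<le> n \<longrightarrow> s j < s k)"
proof -
  define m where "m = Max (s ` {..n})"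
  define k where "k = Max {i\<in>{..n}. s i = m}"
  have "m \<in> s ` {..n}" unfolding m_def by (intro Max_in) auto
  then have ne: "{i\<in>{..n}. s i = m} \<noteq> {}" by auto
  have k: "k \<in> {i\<in>{..n}. s i = m}" unfolding k_def using ne by (intro Max_in) auto
  have le: "s j \<le> m" if "j \<le> n" for j unfolding m_def using that by (intro Max_ge) auto
  have "s j \<noteq> m" if "k < j" "j \<le> n" for j
  proof
    assume "s j = m"
    then have "j \<le> k" unfolding k_def using that by (intro Max_ge) auto
    with that show False by simp
  qed
  then show ?thesis using k le by (intro exI[of _ k]) (auto simp: order.strict_iff_order)
qed

lemma first_neg:
  fixes s :: "nat \<Rightarrow> int"
  assumes "s 0 = 0" "\<And>i. i < n \<Longrightarrow> s i - 1 \<le> s (Suc i)" "s n < 0"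
  shows "\<exists>j\<le>n. s j = -1 \<and> (\<forall>i<j. 0 \<le> s i)"
proof -
  define j where "j = (LEAST i. s i < 0)"
  have j: "s j < 0" unfolding j_def using assms(3) by (rule LeastI)
  have jn: "j \<le> n" unfolding j_def using assms(3) by (rule Least_le)
  have before: "0 \<le> s i" if "i < j" for i using not_less_Least that unfolding j_def by force
  have "j \<noteq> 0" using j assms(1) by (metis less_irrefl)
  then obtain i where i: "j = Suc i" by (cases j) auto
  then have "s i - 1 \<le> s j" using assms(2) jn by auto
  then have "s j = -1" using j before[of i] i by auto
  then show ?thesis using jn before by blast
qed

lemma psum_first_neg:
  assumes "\<And>x. x \<in> set xs \<Longrightarrow> -1 \<le> x" "n \<le> length xs" "psum xs n < 0"
  shows "\<exists>j\<le>n. psum xs j = -1 \<and> (\<forall>i<j. 0 \<le> psum xs i)"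
proof (rule first_neg)
  fix i assume "i < n"
  then have il: "i < length xs" using assms(2) by simp
  then have "-1 \<le> xs ! i" using assms(1) nth_mem by blast
  then show "psum xs i - 1 \<le> psum xs (Suc i)" using il by (simp add: psum_Suc)
qed (use assms in auto)

section \<open>Spitzer's identity and duality for skip-free walks\<close>

text \<open>
  Steps are at least \<open>-1\<close>, so the walk cannot pass below a level without visiting it.
\<close>

locale skip_free_walk =
  fixes \<mu> :: "int pmf"
  assumes step_ge: "\<And>x. x \<in> set_pmf \<mu> \<Longrightarrow> -1 \<le> x"
begin

abbreviation pr :: "nat \<Rightarrow> (int list \<Rightarrow> bool) \<Rightarrow> real" where
  "pr n A \<equiv> measure_pmf.prob (replicate_pmf n \<mu>) {xs. A xs}"

definition stay_nonneg :: "nat \<Rightarrow> real" where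
  "stay_nonneg n = pr n (\<lambda>xs. \<forall>i\<le>n. 0 \<le> psum xs i)"
definition stay_neg :: "nat \<Rightarrow> real" where
  "stay_neg n = pr n (\<lambda>xs. \<forall>i\<in>{1..n}. psum xs i < 0)"
definition end_nonneg :: "nat \<Rightarrow> real" where
  "end_nonneg n = pr n (\<lambda>xs. 0 \<le> sum_list xs)"
text \<open>
  The probability that the walk started at \<open>k\<close> is at 0 for the first time at time \<open>n\<close>. In particular
  \<open>hit n 1\<close> is the law of the first time at which the walk started at 0 becomes negative.
\<close>

definition hit :: "nat \<Rightarrow> int \<Rightarrow> real" where
  "hit n k = pr n (\<lambda>xs. k + sum_list xs = 0 \<and> (\<forall>i<n. 0 < k + psum xs i))"

lemma pr_cong:
  assumes "\<And>xs. length xs = n \<Longrightarrow> (\<And>x. x \<in> set xs \<Longrightarrow> -1 \<le> x) \<Longrightarrow> A xs \<longleftrightarrow> B xs"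
  shows "pr n A = pr n B"
  by (rule measure_pmf.finite_measure_eq_AE)
    (use assms step_ge in \<open>auto simp: AE_measure_pmf_iff set_replicate_pmf lists_eq_set subset_eq\<close>)

lemma pr_mono:
  assumes "\<And>xs. length xs = n \<Longrightarrow> (\<And>x. x \<in> set xs \<Longrightarrow> -1 \<le> x) \<Longrightarrow> A xs \<Longrightarrow> B xs"
  shows "pr n A \<le> pr n B"
  by (rule measure_pmf.finite_measure_mono_AE)
    (use assms step_ge in \<open>auto simp: AE_measure_pmf_iff set_replicate_pmf lists_eq_set subset_eq\<close>)

lemma pr_disjoint_family:
  assumes "finite I"
    and "\<And>xs i j. i \<in> I \<Longrightarrow> j \<in> I \<Longrightarrow> A i xs \<Longrightarrow> A j xs \<Longrightarrow> i = j"
  shows "pr n (\<lambda>xs. \<exists>i\<in>I. A i xs) = (\<Sum>i\<in>I. pr n (A i))"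
proof -
  have "{xs. \<exists>i\<in>I. A i xs} = (\<Union>i\<in>I. {xs. A i xs})" by auto
  then show ?thesis
    using assms by (auto intro!: measure_pmf.finite_measure_finite_Union simp: disjoint_family_on_def)
qed

text \<open>
  Let \<open>k\<close> be the last time at which the path attains its maximum. Seen from time \<open>k\<close> backwards the path
  stays nonnegative for \<open>k\<close> steps, and afterwards it stays strictly below its value at \<open>k\<close>. Reversal
  preserves the law of the first \<open>k\<close> steps and the later ones are independent of them.
\<close>

lemma stay_duality: "(\<Sum>k\<le>n. stay_nonneg k * stay_neg (n - k)) = 1"
proof -
  let ?A = "\<lambda>k xs. (\<forall>i\<le>k. 0 \<le> psum (rev (take k xs)) i) \<and> (\<forall>i\<in>{1..n-k}. psum (drop k xs) i < 0)"
  have A: "?A k xs \<longleftrightarrow> (\<forall>j\<le>k. psum xs j \<le> psum xs k) \<and> (\<forall>j. k < j \<and> j \<le> n \<longrightarrow> psum xs j < psum xs k)"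
    if "length xs = n" "k \<le> n" for k xs
  proof -
    have "(\<forall>i\<le>k. 0 \<le> psum (rev (take k xs)) i) \<longleftrightarrow> (\<forall>i\<le>k. psum xs (k - i) \<le> psum xs k)"
      using that by (auto simp: psum_rev psum_take min_def) (simp_all add: psum_def)
    also have "\<dots> \<longleftrightarrow> (\<forall>j\<le>k. psum xs j \<le> psum xs k)"
      by (metis diff_diff_cancel diff_le_self)
    finally have 1: "(\<forall>i\<le>k. 0 \<le> psum (rev (take k xs)) i) \<longleftrightarrow> (\<forall>j\<le>k. psum xs j \<le> psum xs k)" .
    have "(\<forall>i\<in>{1..n-k}. psum (drop k xs) i < 0) \<longleftrightarrow> (\<forall>j. k < j \<and> j \<le> n \<longrightarrow> psum xs j < psum xs k)"
    proof (intro iffI allI impI ballI)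
      fix j assume h: "\<forall>i\<in>{1..n-k}. psum (drop k xs) i < 0" and j: "k < j \<and> j \<le> n"
      from j have "j - k \<in> {1..n-k}" by auto
      with h have "psum (drop k xs) (j - k) < 0" by blast
      then show "psum xs j < psum xs k" using j by (simp add: psum_drop)
    next
      fix i assume h: "\<forall>j. k < j \<and> j \<le> n \<longrightarrow> psum xs j < psum xs k" and i: "i \<in> {1..n-k}"
      then have "psum xs (k + i) < psum xs k" by auto
      then show "psum (drop k xs) i < 0" by (simp add: psum_drop)
    qed
    with 1 show ?thesis by simp
  qed
  have factor: "stay_nonneg k * stay_neg (n - k) = pr n (?A k)" if "k \<le> n" for k
  proof -
    have "stay_nonneg k = measure_pmf.prob (map_pmf rev (replicate_pmf k \<mu>)) {xs. \<forall>i\<le>k. 0 \<le> psum xs i}"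
      by (simp add: stay_nonneg_def map_rev_replicate_pmf)
    also have "\<dots> = pr k (\<lambda>xs. \<forall>i\<le>k. 0 \<le> psum (rev xs) i)" by (simp add: vimage_def)
    finally show ?thesis
      unfolding stay_neg_def
        prob_take_drop[OF that, where A = "\<lambda>xs. \<forall>i\<le>k. 0 \<le> psum (rev xs) i"
          and B = "\<lambda>xs. \<forall>i\<in>{1..n-k}. psum xs i < 0"]
      by simp
  qed
  have "(\<Sum>k\<le>n. stay_nonneg k * stay_neg (n - k)) = (\<Sum>k\<le>n. pr n (\<lambda>xs. length xs = n \<and> ?A k xs))"
  proof (rule sum.cong[OF refl])
    fix k assume "k \<in> {..n}"
    then have "stay_nonneg k * stay_neg (n - k) = pr n (?A k)" by (intro factor) simp
    also have "\<dots> = pr n (\<lambda>xs. length xs = n \<and> ?A k xs)" by (rule pr_cong) simp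
    finally show "stay_nonneg k * stay_neg (n - k) = pr n (\<lambda>xs. length xs = n \<and> ?A k xs)" .
  qed
  also have "\<dots> = pr n (\<lambda>xs. \<exists>k\<in>{..n}. length xs = n \<and> ?A k xs)"
  proof (rule pr_disjoint_family[symmetric])
    fix xs i j assume ij: "i \<in> {..n}" "j \<in> {..n}" "length xs = n \<and> ?A i xs" "length xs = n \<and> ?A j xs"
    have i: "(\<forall>m\<le>i. psum xs m \<le> psum xs i) \<and> (\<forall>m. i < m \<and> m \<le> n \<longrightarrow> psum xs m < psum xs i)"
      using A[of xs i] ij(1,3) by simp
    have j: "(\<forall>m\<le>j. psum xs m \<le> psum xs j) \<and> (\<forall>m. j < m \<and> m \<le> n \<longrightarrow> psum xs m < psum xs j)"
      using A[of xs j] ij(2,4) by simp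
    have "\<not> i < j"
    proof
      assume "i < j"
      then have "psum xs j < psum xs i" "psum xs i \<le> psum xs j" using i j ij(1,2) by simp_all
      then show False by simp
    qed
    moreover have "\<not> j < i"
    proof
      assume "j < i"
      then have "psum xs i < psum xs j" "psum xs j \<le> psum xs i" using i j ij(1,2) by simp_all
      then show False by simp
    qed
    ultimately show "i = j" by simp
  qed simp
  also have "\<dots> = pr n (\<lambda>xs. True)"
  proof (rule pr_cong)
    fix xs :: "int list" assume l: "length xs = n"
    obtain k where "k \<le> n" "(\<forall>j\<le>k. psum xs j \<le> psum xs k) \<and> (\<forall>j. k < j \<and> j \<le> n \<longrightarrow> psum xs j < psum xs k)"
      using last_argmax[of n "psum xs"] by blast
    with A[OF l this(1)] l show "(\<exists>k\<in>{..n}. length xs = n \<and> ?A k xs) \<longleftrightarrow> True" by blast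
  qed
  also have "\<dots> = 1" using measure_pmf.prob_space[of "replicate_pmf n \<mu>"] by simp
  finally show ?thesis .
qed

lemma stay_nonneg_Suc: "stay_nonneg n = stay_nonneg (Suc n) + hit (Suc n) 1"
proof -
  have "stay_nonneg n = pr (Suc n) (\<lambda>xs. (\<forall>i\<le>n. 0 \<le> psum (take n xs) i) \<and> True)"
    unfolding stay_nonneg_def
    by (subst prob_take_drop[where A = "\<lambda>xs. \<forall>i\<le>n. 0 \<le> psum xs i" and B = "\<lambda>_. True"])
      (use measure_pmf.prob_space[of "replicate_pmf (Suc 0) \<mu>"] in auto)
  also have "\<dots> = pr (Suc n) (\<lambda>xs. \<exists>b\<in>UNIV.
      (if b then \<forall>i\<le>Suc n. 0 \<le> psum xs i else 1 + psum xs (Suc n) = 0 \<and> (\<forall>i<Suc n. 0 < 1 + psum xs i)))"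
  proof (rule pr_cong)
    fix xs :: "int list" assume l: "length xs = Suc n" and s: "\<And>x. x \<in> set xs \<Longrightarrow> -1 \<le> x"
    have "xs ! n \<ge> -1" using l s by (metis lessI nth_mem)
    then have step: "psum xs (Suc n) \<ge> psum xs n - 1" using l psum_Suc[of n xs] by linarith
    have "(\<forall>i\<le>n. 0 \<le> psum xs i) \<longleftrightarrow> (\<forall>i\<le>Suc n. 0 \<le> psum xs i) \<or>
        1 + psum xs (Suc n) = 0 \<and> (\<forall>i<Suc n. 0 < 1 + psum xs i)"
      using step by (force simp: le_Suc_eq less_Suc_eq_le)
    then show "((\<forall>i\<le>n. 0 \<le> psum (take n xs) i) \<and> True) = (\<exists>b\<in>UNIV.
      (if b then \<forall>i\<le>Suc n. 0 \<le> psum xs i else 1 + psum xs (Suc n) = 0 \<and> (\<forall>i<Suc n. 0 < 1 + psum xs i)))"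
      by (auto simp: psum_take ex_bool_eq)
  qed
  also have "\<dots> = (\<Sum>b\<in>UNIV. pr (Suc n) (\<lambda>xs.
      (if b then \<forall>i\<le>Suc n. 0 \<le> psum xs i else 1 + psum xs (Suc n) = 0 \<and> (\<forall>i<Suc n. 0 < 1 + psum xs i))))"
    by (rule pr_disjoint_family) (fastforce split: if_splits)+
  also have "\<dots> = stay_nonneg (Suc n) + pr (Suc n) (\<lambda>xs. 1 + psum xs (Suc n) = 0 \<and> (\<forall>i<Suc n. 0 < 1 + psum xs i))"
    by (simp add: UNIV_bool stay_nonneg_def)
  also have "pr (Suc n) (\<lambda>xs. 1 + psum xs (Suc n) = 0 \<and> (\<forall>i<Suc n. 0 < 1 + psum xs i)) = hit (Suc n) 1"
    unfolding hit_def by (rule pr_cong) simp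
  finally show ?thesis .
qed

text \<open>
  A path ending strictly below \<open>-1\<close> visits \<open>-1\<close> before; the summand \<open>j\<close> corresponds to first visiting
  \<open>-1\<close> at time \<open>j\<close> and then descending further.
\<close>

lemma below_decomposition:
  "pr n (\<lambda>xs. sum_list xs < 0) =
    pr n (\<lambda>xs. sum_list xs = -1) + (\<Sum>j\<le>n. hit j 1 * pr (n - j) (\<lambda>xs. sum_list xs < 0))"
proof -
  let ?A = "\<lambda>j xs. (1 + sum_list (take j xs) = 0 \<and> (\<forall>i<j. 0 < 1 + psum (take j xs) i)) \<and> sum_list (drop j xs) < 0"
  have "(\<Sum>j\<le>n. hit j 1 * pr (n - j) (\<lambda>xs. sum_list xs < 0)) = (\<Sum>j\<le>n. pr n (?A j))"
    unfolding hit_def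
    by (intro sum.cong refl prob_take_drop[symmetric,
        where A = "\<lambda>xs. 1 + sum_list xs = 0 \<and> (\<forall>i<j. 0 < 1 + psum xs i)" and B = "\<lambda>xs. sum_list xs < 0" for j]) auto
  also have "\<dots> = pr n (\<lambda>xs. \<exists>j\<in>{..n}. ?A j xs)"
  proof (rule pr_disjoint_family[symmetric])
    fix xs i j assume ij: "i \<in> {..n}" "j \<in> {..n}" "?A i xs" "?A j xs"
    have "psum xs i = -1" "psum xs j = -1" using ij(3,4) by (auto simp: psum_def)
    moreover have "0 \<le> psum xs k" if "k < i" for k using ij(3) that by (auto simp: psum_take less_imp_le)
    moreover have "0 \<le> psum xs k" if "k < j" for k using ij(4) that by (auto simp: psum_take less_imp_le)
    ultimately have "\<not> i < j" "\<not> j < i" by force+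
    then show "i = j" by simp
  qed simp
  also have "\<dots> = pr n (\<lambda>xs. sum_list xs < -1)"
  proof (rule pr_cong)
    fix xs :: "int list" assume l: "length xs = n" and s: "\<And>x. x \<in> set xs \<Longrightarrow> -1 \<le> x"
    have sum: "sum_list xs = sum_list (take j xs) + sum_list (drop j xs)" for j
      by (metis append_take_drop_id sum_list_append)
    show "(\<exists>j\<in>{..n}. ?A j xs) \<longleftrightarrow> sum_list xs < -1"
    proof
      assume "\<exists>j\<in>{..n}. ?A j xs"
      then obtain j where "?A j xs" by blast
      with sum[of j] show "sum_list xs < -1" by linarith
    next
      assume neg: "sum_list xs < -1"
      then obtain j where j: "j \<le> n" "psum xs j = -1" "\<forall>i<j. 0 \<le> psum xs i"
        using psum_first_neg[of xs n] s l by auto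
      then have "?A j xs" using neg sum[of j] by (auto simp: psum_take) (auto simp: psum_def)
      with j show "\<exists>j\<in>{..n}. ?A j xs" by blast
    qed
  qed
  finally have "(\<Sum>j\<le>n. hit j 1 * pr (n - j) (\<lambda>xs. sum_list xs < 0)) = pr n (\<lambda>xs. sum_list xs < -1)" .
  moreover have "pr n (\<lambda>xs. sum_list xs < 0) = pr n (\<lambda>xs. sum_list xs = -1) + pr n (\<lambda>xs. sum_list xs < -1)"
  proof -
    have "{xs. sum_list xs < 0} = {xs. sum_list xs = -1} \<union> {xs::int list. sum_list xs < -1}" by auto
    then show ?thesis by (simp only:) (rule measure_pmf.finite_measure_Union, auto)
  qed
  ultimately show ?thesis by simp
qed

lemma pr_Suc: "pr (Suc n) A = (\<integral>x. pr n (\<lambda>xs. A (x # xs)) \<partial>\<mu>)"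
proof -
  have "replicate_pmf (Suc n) \<mu> = bind_pmf \<mu> (\<lambda>x. map_pmf ((#) x) (replicate_pmf n \<mu>))"
    by (simp add: map_pmf_def)
  then have "ennreal (pr (Suc n) A) = (\<integral>\<^sup>+x. ennreal (pr n (\<lambda>xs. A (x # xs))) \<partial>\<mu>)"
    by (simp add: measure_pmf.emeasure_eq_measure[symmetric] vimage_def del: replicate_pmf.simps)
  also have "\<dots> = ennreal (\<integral>x. pr n (\<lambda>xs. A (x # xs)) \<partial>\<mu>)"
    by (intro nn_integral_eq_integral measure_pmf.integrable_const_bound[where B=1]) auto
  finally show ?thesis
    by (subst (asm) ennreal_inj) (auto intro!: Bochner_Integration.integral_nonneg)
qed

text \<open>
  The generating function of the steps, shifted by one to have nonnegative exponents. Its powers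
  generate the laws of the endpoint.
\<close>

definition step_fps :: "real fps" where
  "step_fps = Abs_fps (\<lambda>i. pmf \<mu> (int i - 1))"

lemma pr_first_step:
  assumes "\<And>x. -1 \<le> x \<Longrightarrow> int m \<le> x \<Longrightarrow> pr n (\<lambda>xs. A (x # xs)) = 0"
  shows "pr (Suc n) A = (\<Sum>i=0..m. step_fps $ i * pr n (\<lambda>xs. A ((int i - 1) # xs)))"
proof -
  have "pr (Suc n) A = (\<Sum>x\<in>(\<lambda>i. int i - 1) ` {0..m}. pr n (\<lambda>xs. A (x # xs)) * pmf \<mu> x)"
    unfolding pr_Suc
  proof (rule integral_measure_pmf_real)
    fix x assume "x \<in> set_pmf \<mu>" and nz: "pr n (\<lambda>xs. A (x # xs)) \<noteq> 0"
    then have "-1 \<le> x" using step_ge by blast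
    moreover have "x < int m" using assms[OF \<open>-1 \<le> x\<close>] nz by linarith
    ultimately show "x \<in> (\<lambda>i. int i - 1) ` {0..m}" by (intro image_eqI[of _ _ "nat (x + 1)"]) auto
  qed simp
  also have "\<dots> = (\<Sum>i=0..m. step_fps $ i * pr n (\<lambda>xs. A ((int i - 1) # xs)))"
    by (subst sum.reindex) (auto simp: inj_on_def step_fps_def mult.commute)
  finally show ?thesis .
qed

lemma pr_sum_below: "m < - int n \<Longrightarrow> pr n (\<lambda>xs. sum_list xs = m) = 0"
  using pr_cong[of n "\<lambda>xs. sum_list xs = m" "\<lambda>_. False"] sum_list_ge by force

lemma endpoint_fps: "pr n (\<lambda>xs. sum_list xs = int m - int n) = step_fps ^ n $ m"
proof (induction n arbitrary: m)
  case 0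
  then show ?case by (auto simp: indicator_def)
next
  case (Suc n)
  have "pr (Suc n) (\<lambda>xs. sum_list xs = int m - int (Suc n)) =
      (\<Sum>i=0..m. step_fps $ i * pr n (\<lambda>xs. sum_list ((int i - 1) # xs) = int m - int (Suc n)))"
  proof (rule pr_first_step)
    fix x assume "-1 \<le> x" "int m \<le> x"
    then show "pr n (\<lambda>xs. sum_list (x # xs) = int m - int (Suc n)) = 0"
      using pr_sum_below[of "int m - int (Suc n) - x" n] by (simp add: algebra_simps)
  qed
  also have "\<dots> = (\<Sum>i=0..m. step_fps $ i * step_fps ^ n $ (m - i))"
    by (intro sum.cong refl arg_cong2[of _ _ _ _ "(*)"]) (auto simp: Suc.IH[symmetric] of_nat_diff algebra_simps)
  also have "\<dots> = step_fps ^ Suc n $ m" by (simp add: fps_mult_nth)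
  finally show ?case .
qed

lemma hit_eq_0: "int n < k \<Longrightarrow> hit n k = 0"
  unfolding hit_def using pr_cong[of n "\<lambda>xs. k + sum_list xs = 0 \<and> (\<forall>i<n. 0 < k + psum xs i)" "\<lambda>_. False"] sum_list_ge
  by force

lemma hit_0: "hit 0 (int k) = (if k = 0 then 1 else 0)"
  by (auto simp: hit_def indicator_def)

lemma hit_Suc:
  assumes "1 \<le> k" "k + m = Suc n"
  shows "hit (Suc n) (int k) = (\<Sum>i=0..m. step_fps $ i * hit n (int (k - 1 + i)))"
proof -
  \<comment> \<open>the walk from \<open>k\<close> with first step \<open>x\<close> goes on as a walk from \<open>k + x\<close>; positivity at time 0 is \<open>k \<ge> 1\<close>\<close>
  have eq: "pr n (\<lambda>xs. int k + sum_list (x # xs) = 0 \<and> (\<forall>i<Suc n. 0 < int k + psum (x # xs) i)) =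
      hit n (int k + x)" for x
    unfolding hit_def using assms(1)
    by (intro arg_cong[of _ _ "\<lambda>A. measure_pmf.prob _ A"] Collect_cong) (auto simp: less_Suc_eq_0_disj algebra_simps)
  have "hit (Suc n) (int k) = (\<Sum>i=0..m. step_fps $ i * hit n (int k + (int i - 1)))"
    unfolding hit_def[of "Suc n"] eq[symmetric]
  proof (rule pr_first_step)
    fix x assume "-1 \<le> x" "int m \<le> x"
    with assms have "int n < int k + x" by linarith
    then show "pr n (\<lambda>xs. int k + sum_list (x # xs) = 0 \<and> (\<forall>i<Suc n. 0 < int k + psum (x # xs) i)) = 0"
      unfolding eq by (rule hit_eq_0)
  qed
  also have "\<dots> = (\<Sum>i=0..m. step_fps $ i * hit n (int (k - 1 + i)))"
    using assms by (intro sum.cong refl) (auto simp: of_nat_diff algebra_simps)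
  finally show ?thesis .
qed

text \<open>
  Induction on \<open>n\<close> by conditioning on the first step \<open>x\<close>: by the induction hypothesis the claim becomes
  a statement about the mean of \<open>k + x\<close> over the paths from \<open>k\<close> that are at 0 at time \<open>n + 1\<close>. By
  exchangeability \<open>x\<close> has mean \<open>-k / (n + 1)\<close> on these paths, which for generating functions is the
  rule for the derivative of the power of \<open>step_fps\<close>.
\<close>

lemma hitting_time_theorem:
  "real n * hit n (int k) = real k * (if k \<le> n then step_fps ^ n $ (n - k) else 0)"
proof (induction n arbitrary: k)
  case 0
  then show ?case by (simp add: hit_0)
next
  case (Suc n)
  consider "k = 0" | "k > Suc n" | "1 \<le> k" "k \<le> Suc n" by linarith
  then show ?case
  proof cases
    case 1
    have "hit (Suc n) 0 = pr (Suc n) (\<lambda>_. False)"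
      unfolding hit_def by (rule pr_cong) (auto intro!: exI[of _ 0])
    then show ?thesis using 1 by simp
  next
    case 2
    then show ?thesis by (simp add: hit_eq_0)
  next
    case 3
    define m where "m = Suc n - k"
    have m: "k + m = Suc n" using 3 unfolding m_def by simp
    define c where "c = step_fps ^ Suc n $ m"
    have hit_rec: "hit (Suc n) (int k) = (\<Sum>i=0..m. step_fps $ i * hit n (int (k - 1 + i)))"
      by (rule hit_Suc) (use 3 m in auto)
    have "real (Suc n) * hit (Suc n) (int k) = real k * c"
    proof (cases "n = 0")
      case True
      then have "k = 1" "m = 0" using 3 m by auto
      then show ?thesis using True unfolding hit_rec c_def by (simp add: hit_0[of 0, simplified])
    next
      case False
      have deriv: "real (Suc n) * (\<Sum>i=0..m. real i * step_fps $ i * step_fps ^ n $ (m - i)) = real m * c"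
      proof -
        have "of_nat (Suc n) * (fps_X * fps_deriv step_fps * step_fps ^ n) = fps_X * fps_deriv (step_fps ^ Suc n)"
          unfolding fps_deriv_power' by (simp add: mult_ac del: of_nat_Suc)
        then have "(of_nat (Suc n) * (fps_X * fps_deriv step_fps * step_fps ^ n)) $ m =
            (fps_X * fps_deriv (step_fps ^ Suc n)) $ m" by (rule arg_cong)
        also have "\<dots> = real m * c"
          unfolding c_def by (cases m) (simp_all del: power_Suc)
        finally have "(of_nat (Suc n) * (fps_X * fps_deriv step_fps * step_fps ^ n)) $ m = real m * c" .
        moreover have "(fps_X * fps_deriv step_fps) $ i = real i * step_fps $ i" for i
          by (cases i) simp_all
        ultimately show ?thesis
          by (simp add: fps_mult_nth[of "fps_X * fps_deriv step_fps"] fps_mult_of_nat_nth del: of_nat_Suc)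
      qed
      have "real n * hit (Suc n) (int k) = (\<Sum>i=0..m. step_fps $ i * (real n * hit n (int (k - 1 + i))))"
        unfolding hit_rec sum_distrib_left by (simp add: mult_ac)
      also have "\<dots> = (\<Sum>i=0..m. step_fps $ i * ((real k - 1 + real i) * step_fps ^ n $ (m - i)))"
      proof (rule sum.cong[OF refl])
        fix i assume "i \<in> {0..m}"
        then have "k - 1 + i \<le> n" "n - (k - 1 + i) = m - i" using 3 m by auto
        then show "step_fps $ i * (real n * hit n (int (k - 1 + i))) =
            step_fps $ i * ((real k - 1 + real i) * step_fps ^ n $ (m - i))"
          using 3 unfolding Suc.IH by (simp add: of_nat_diff)
      qed
      also have "\<dots> = (real k - 1) * (\<Sum>i=0..m. step_fps $ i * step_fps ^ n $ (m - i)) +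
          (\<Sum>i=0..m. real i * step_fps $ i * step_fps ^ n $ (m - i))"
        unfolding sum_distrib_left sum.distrib[symmetric] by (intro sum.cong refl) (simp add: algebra_simps)
      also have "(\<Sum>i=0..m. step_fps $ i * step_fps ^ n $ (m - i)) = c"
        unfolding c_def by (simp add: fps_mult_nth)
      finally have "real (Suc n) * (real n * hit (Suc n) (int k)) = real (Suc n) * ((real k - 1) * c) +
          real (Suc n) * (\<Sum>i=0..m. real i * step_fps $ i * step_fps ^ n $ (m - i))"
        by (simp only: distrib_left)
      also note deriv
      also have "real m = real (Suc n) - real k" using m by linarith
      finally have "real n * (real (Suc n) * hit (Suc n) (int k)) = real n * (real k * c)"
        by (simp add: algebra_simps)
      then show ?thesis using False by simp
    qed
    then show ?thesis using 3 unfolding c_def m_def by simp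
  qed
qed

lemma hit_one: "real n * hit n 1 = pr n (\<lambda>xs. sum_list xs = -1)"
proof (cases n)
  case (Suc n')
  then show ?thesis
    using hitting_time_theorem[of n 1] endpoint_fps[of n "n - 1"] by simp
qed simp

lemma end_nonneg_compl: "pr n (\<lambda>xs. sum_list xs < 0) = 1 - end_nonneg n"
proof -
  have "{xs. sum_list xs < 0} = UNIV - {xs. 0 \<le> (sum_list xs :: int)}" by auto
  then show ?thesis
    unfolding end_nonneg_def using measure_pmf.prob_compl[of "{xs. 0 \<le> sum_list xs}" "replicate_pmf n \<mu>"] by simp
qed

lemma stay_nonneg_0: "stay_nonneg 0 = 1"
  by (simp add: stay_nonneg_def)

text \<open>
  In terms of generating functions let \<open>F\<close> belong to \<open>hit n 1\<close>, \<open>Q\<close> to the probabilities of being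
  negative at time \<open>n\<close>, \<open>S\<close> to \<open>stay_nonneg\<close> and \<open>P\<close> to \<open>end_nonneg\<close>. The decomposition at the first
  passage and the hitting time theorem give \<open>z F' = Q (1 - F)\<close>, and \<open>(1 - z) S = 1 - F\<close>. Therefore
  the logarithmic derivative of \<open>S\<close> times \<open>z\<close> is \<open>z / (1 - z) - Q = P\<close>.
\<close>

lemma spitzer_identity:
  "real n * stay_nonneg n = (\<Sum>k=1..n. end_nonneg k * stay_nonneg (n - k))"
proof -
  define F where "F = Abs_fps (\<lambda>n. hit n 1)"
  define Q where "Q = Abs_fps (\<lambda>n. pr n (\<lambda>xs. sum_list xs < 0))"
  define S where "S = Abs_fps stay_nonneg"
  define P where "P = Abs_fps (\<lambda>n. if n = 0 then 0 else end_nonneg n)"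
  have X_deriv: "(fps_X * fps_deriv f) $ n = real n * f $ n" for f :: "real fps" and n
    by (cases n) simp_all
  have first_passage: "fps_X * fps_deriv F = Q * (1 - F)"
  proof -
    have "Q $ n = (fps_X * fps_deriv F + F * Q) $ n" for n
      unfolding fps_add_nth X_deriv
      by (simp add: Q_def F_def hit_one fps_mult_nth below_decomposition[of n] atMost_atLeast0)
    then have "Q = fps_X * fps_deriv F + F * Q" by (rule fps_ext)
    then show ?thesis by (simp add: algebra_simps)
  qed
  have survival: "(1 - fps_X) * S = 1 - F"
  proof (rule fps_ext)
    fix n show "((1 - fps_X) * S) $ n = (1 - F) $ n"
      using hit_0[of 1] stay_nonneg_Suc[of "n - 1"]
      by (cases n) (simp_all add: S_def F_def stay_nonneg_0 algebra_simps)
  qed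
  have total: "(1 - fps_X) * (P + Q) = fps_X"
  proof (rule fps_ext)
    fix n
    have PQ: "(P + Q) $ n = (if n = 0 then 0 else 1)" for n
      by (simp add: P_def Q_def end_nonneg_compl) (simp add: end_nonneg_def)
    have "((1 - fps_X) * (P + Q)) $ n = (P + Q) $ n - (fps_X * (P + Q)) $ n"
      by (simp only: left_diff_distrib mult_1_left fps_sub_nth)
    then show "((1 - fps_X) * (P + Q)) $ n = (fps_X :: real fps) $ n"
      unfolding fps_X_mult_nth PQ by (simp add: fps_X_nth)
  qed
  have "fps_X * fps_deriv ((1 - fps_X) * S) = - (Q * ((1 - fps_X) * S))"
    unfolding survival using first_passage by simp
  then have "(1 - fps_X) * (fps_X * fps_deriv S) = fps_X * S - Q * ((1 - fps_X) * S)"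
    by (simp add: algebra_simps)
  also have "\<dots> = ((1 - fps_X) * (P + Q)) * S - Q * ((1 - fps_X) * S)" by (simp only: total)
  also have "\<dots> = (1 - fps_X) * (P * S)" by (simp add: algebra_simps)
  finally have eq: "(1 - fps_X) * (fps_X * fps_deriv S) = (1 - fps_X) * (P * S)" .
  have "(1 - fps_X :: real fps) $ 0 \<noteq> 0 $ 0" by simp
  then have "(1 - fps_X :: real fps) \<noteq> 0" by metis
  with eq have "fps_X * fps_deriv S = P * S" by simp
  then have "real n * S $ n = (P * S) $ n" unfolding X_deriv[symmetric] by simp
  also have "\<dots> = (\<Sum>k=0..n. P $ k * S $ (n - k))" by (rule fps_mult_nth)
  also have "\<dots> = (\<Sum>k=1..n. end_nonneg k * stay_nonneg (n - k))"
    by (rule sum.mono_neutral_cong_right) (auto simp: P_def S_def)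
  finally show ?thesis by (simp add: S_def)
qed

lemma stay_nonneg_antimono: "m \<le> n \<Longrightarrow> stay_nonneg n \<le> stay_nonneg m"
proof (rule lift_Suc_antimono_le[of stay_nonneg])
  show "stay_nonneg (Suc n) \<le> stay_nonneg n" for n
    using stay_nonneg_Suc[of n] by (simp add: hit_def)
qed

lemma stay_neg_antimono: "m \<le> n \<Longrightarrow> stay_neg n \<le> stay_neg m"
proof -
  assume mn: "m \<le> n"
  have "stay_neg m = pr n (\<lambda>xs. (\<forall>i\<in>{1..m}. psum (take m xs) i < 0) \<and> True)"
    unfolding stay_neg_def using mn
    by (subst prob_take_drop[where A = "\<lambda>xs. \<forall>i\<in>{1..m}. psum xs i < 0" and B = "\<lambda>_. True"])
      (use measure_pmf.prob_space[of "replicate_pmf (n - m) \<mu>"] in auto)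
  moreover have "stay_neg n \<le> \<dots>"
    unfolding stay_neg_def using mn by (intro pr_mono) (auto simp: psum_take)
  ultimately show ?thesis by simp
qed

lemma stay_nonneg_pos:
  assumes "0 < measure_pmf.prob \<mu> {0..}"
  shows "0 < stay_nonneg n"
proof -
  have "stay_nonneg n > 0" if "\<exists>x\<in>set_pmf \<mu>. 0 \<le> x" for n
  proof -
    obtain x where x: "x \<in> set_pmf \<mu>" "0 \<le> x" using \<open>\<exists>x\<in>set_pmf \<mu>. 0 \<le> x\<close> by blast
    have "replicate n x \<in> set_pmf (replicate_pmf n \<mu>)" using x by (auto simp: set_replicate_pmf)
    moreover have "\<forall>i\<le>n. 0 \<le> psum (replicate n x) i" using x by (simp add: psum_def sum_list_replicate)
    ultimately show ?thesis unfolding stay_nonneg_def by (intro measure_pmf_posI) auto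
  qed
  moreover have "\<exists>x\<in>set_pmf \<mu>. 0 \<le> x"
    using assms by (metis atLeast_iff disjoint_iff less_irrefl measure_Int_set_pmf measure_empty)
  ultimately show ?thesis by blast
qed

end

section \<open>Regularly varying tails of index -1\<close>

text \<open>
  The tail \<open>T\<close> is regularly varying of index \<open>-1\<close>. As it is monotone, its pointwise asymptotics give
  bounds that are uniform in the argument.
\<close>

locale cauchy_walk = skip_free_walk +
  fixes T :: "real \<Rightarrow> real"
  assumes T_def: "\<And>x. T x = measure_pmf.prob \<mu> {k. x \<le> real_of_int k}"
    and integrable_step: "integrable (measure_pmf \<mu>) real_of_int"
    and mean_zero: "measure_pmf.expectation \<mu> real_of_int = 0"
    and T_pos: "\<And>x. 0 < T x"
    and T_regular: "\<And>c. 0 < c \<Longrightarrow> ((\<lambda>x. T (c * x) / T x) \<longlongrightarrow> 1 / c) at_top"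
begin

text \<open>
  As the steps have mean zero, \<open>- tail_mean x\<close> is the mean of the steps truncated at \<open>x\<close>.
\<close>

definition tail_mean :: "real \<Rightarrow> real" where
  "tail_mean x = (\<integral>k. real_of_int k * indicator {k. x < real_of_int k} k \<partial>\<mu>)"

definition cut_moment :: "real \<Rightarrow> real" where
  "cut_moment y = (\<integral>k. (real_of_int k)\<^sup>2 * indicator {k. real_of_int k \<le> y} k \<partial>\<mu>)"

lemma T_eq: "T x = (\<integral>k. indicator {k. x \<le> real_of_int k} k \<partial>\<mu>)"
  unfolding T_def by simp

lemma T_antimono: "x \<le> y \<Longrightarrow> T y \<le> T x"
  unfolding T_def by (rule measure_pmf.finite_measure_mono) auto

lemma T_le_1: "T x \<le> 1" unfolding T_def by simp

lemma integrable_T: "integrable (measure_pmf \<mu>) (indicator {k. x \<le> real_of_int k} :: int \<Rightarrow> real)"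
  by (rule measure_pmf.integrable_const_bound[where B=1]) (auto simp: indicator_def)

lemma integrable_cut: "integrable (measure_pmf \<mu>) (\<lambda>k. real_of_int k * indicator A k)"
  by (rule Bochner_Integration.integrable_bound[OF integrable_step]) (auto simp: indicator_def)

lemma integrable_cut_moment: "integrable (measure_pmf \<mu>) (\<lambda>k. (real_of_int k)\<^sup>2 * indicator {k. real_of_int k \<le> y} k)"
proof (rule measure_pmf.integrable_const_bound[where B="(max 1 y)\<^sup>2"])
  have "(real_of_int k)\<^sup>2 \<le> (max 1 y)\<^sup>2" if "-1 \<le> k" "real_of_int k \<le> y" for k
    using that by (intro power2_le_iff_abs_le[THEN iffD2]) auto
  then show "AE k in \<mu>. norm ((real_of_int k)\<^sup>2 * indicator {k. real_of_int k \<le> y} k) \<le> (max 1 y)\<^sup>2"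
    using step_ge by (auto simp: AE_measure_pmf_iff indicator_def)
qed simp

lemmas integrables = integrable_cut integrable_cut_moment integrable_T integrable_step
  Bochner_Integration.integrable_add Bochner_Integration.integrable_diff integrable_mult_right

lemma integral_mono_pointwise:
  fixes f g :: "int \<Rightarrow> real"
  assumes "integrable (measure_pmf \<mu>) f" "integrable (measure_pmf \<mu>) g" "\<And>k. -1 \<le> k \<Longrightarrow> f k \<le> g k"
  shows "(\<integral>k. f k \<partial>\<mu>) \<le> (\<integral>k. g k \<partial>\<mu>)"
  using assms step_ge by (intro integral_mono_AE) (auto simp: AE_measure_pmf_iff)

lemma tail_mean_antimono:
  assumes "0 \<le> x" "x \<le> y"
  shows "tail_mean y \<le> tail_mean x"
  unfolding tail_mean_def
  by (rule integral_mono_pointwise) (intro integrables | use assms in \<open>auto simp: indicator_def\<close>)+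

lemma cut_moment_nonneg: "0 \<le> cut_moment y"
  unfolding cut_moment_def by (rule Bochner_Integration.integral_nonneg) auto

lemma cut_moment_mono: "x \<le> y \<Longrightarrow> cut_moment x \<le> cut_moment y"
  unfolding cut_moment_def by (rule integral_mono_pointwise) (intro integrables | auto simp: indicator_def)+

lemma T_scaled_le:
  assumes "0 < c" "1 / c < d"
  shows "\<forall>\<^sub>F x in at_top. T (c * x) \<le> d * T x"
  using order_tendstoD(2)[OF T_regular[OF assms(1)] assms(2)]
  by eventually_elim (use T_pos in \<open>simp add: pos_divide_less_eq less_imp_le\<close>)

lemma T_scaled_ge:
  assumes "0 < c" "d < 1 / c"
  shows "\<forall>\<^sub>F x in at_top. d * T x \<le> T (c * x)"
  using order_tendstoD(1)[OF T_regular[OF assms(1)] assms(2)]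
  by eventually_elim (use T_pos in \<open>simp add: pos_less_divide_eq less_imp_le\<close>)

text \<open>
  Passing from \<open>y\<close> to \<open>2 * y\<close> multiplies \<open>y\<^sup>2 * T y\<close> by about 2, hence by at least \<open>4 / 3\<close>, and adds at
  most \<open>4 * y\<^sup>2 * T y\<close> to the truncated second moment. So the bound propagates along doublings, once
  \<open>K\<close> is at least 12 and large enough on the first dyadic block.
\<close>

lemma cut_moment_le: "\<exists>K>0. \<forall>\<^sub>F y in at_top. cut_moment y \<le> K * (y\<^sup>2 * T y)"
proof -
  obtain y1 where y1: "\<And>y. y \<ge> y1 \<Longrightarrow> 1/3 * T y \<le> T (2 * y)"
    using T_scaled_ge[of 2 "1/3"] unfolding eventually_at_top_linorder by auto
  define y0 where "y0 = max 1 y1"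
  have y0: "y0 \<ge> 1" "\<And>y. y \<ge> y0 \<Longrightarrow> T y \<le> 3 * T (2 * y)"
    using y1 unfolding y0_def by force+
  define K where "K = max 12 (cut_moment (2 * y0) / (y0\<^sup>2 * T (2 * y0)))"
  have base: "cut_moment (2 * y0) \<le> K * (y0\<^sup>2 * T (2 * y0))"
  proof -
    have "cut_moment (2 * y0) / (y0\<^sup>2 * T (2 * y0)) \<le> K" unfolding K_def by simp
    then show ?thesis using y0 T_pos[of "2 * y0"] by (simp add: pos_divide_le_eq)
  qed
  have double: "cut_moment (2 * y) \<le> cut_moment y + 4 * y\<^sup>2 * T y" if "y > 0" for y
  proof -
    have "cut_moment (2 * y) \<le> (\<integral>k. (real_of_int k)\<^sup>2 * indicator {k. real_of_int k \<le> y} k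
        + 4 * y\<^sup>2 * indicator {k. y \<le> real_of_int k} k \<partial>\<mu>)"
      unfolding cut_moment_def
    proof (rule integral_mono_pointwise)
      fix k :: int assume "-1 \<le> k"
      have "(real_of_int k)\<^sup>2 \<le> 4 * y\<^sup>2" if "y < real_of_int k" "real_of_int k \<le> 2 * y"
      proof -
        have "(real_of_int k)\<^sup>2 \<le> (2 * y)\<^sup>2" using that \<open>y > 0\<close> by (intro power_mono) auto
        then show ?thesis by simp
      qed
      then show "(real_of_int k)\<^sup>2 * indicator {k. real_of_int k \<le> 2 * y} k \<le>
        (real_of_int k)\<^sup>2 * indicator {k. real_of_int k \<le> y} k + 4 * y\<^sup>2 * indicator {k. y \<le> real_of_int k} k"
        by (auto simp: indicator_def)
    qed (intro integrables)+
    also have "\<dots> = cut_moment y + 4 * y\<^sup>2 * T y"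
      unfolding cut_moment_def T_eq by (subst Bochner_Integration.integral_add) (intro integrables | simp)+
    finally show ?thesis .
  qed
  have K: "K \<ge> 12" unfolding K_def by simp
  have dyadic: "\<forall>y. y0 \<le> y \<and> y \<le> 2 ^ Suc n * y0 \<longrightarrow> cut_moment y \<le> K * (y\<^sup>2 * T y)" for n
  proof (induction n)
    case 0
    show ?case
    proof (intro allI impI)
      fix y assume y: "y0 \<le> y \<and> y \<le> 2 ^ Suc 0 * y0"
      have "cut_moment y \<le> cut_moment (2 * y0)" using y by (intro cut_moment_mono) auto
      also note base
      also have "K * (y0\<^sup>2 * T (2 * y0)) \<le> K * (y\<^sup>2 * T y)"
        using y y0 K T_pos by (intro mult_left_mono mult_mono power_mono T_antimono) (auto simp: less_imp_le)
      finally show "cut_moment y \<le> K * (y\<^sup>2 * T y)" .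
    qed
  next
    case (Suc n)
    show ?case
    proof (intro allI impI)
      fix y assume y: "y0 \<le> y \<and> y \<le> 2 ^ Suc (Suc n) * y0"
      show "cut_moment y \<le> K * (y\<^sup>2 * T y)"
      proof (cases "y \<le> 2 ^ Suc n * y0")
        case True then show ?thesis using Suc.IH y by blast
      next
        case False
        define z where "z = y / 2"
        have "2 * y0 \<le> 2 ^ Suc n * y0" using y0 by simp
        then have "2 * y0 < y" using False by linarith
        then have z: "y0 \<le> z" "z \<le> 2 ^ Suc n * y0" "y = 2 * z" "z > 0"
          using False y y0 unfolding z_def by auto
        have "cut_moment y \<le> cut_moment z + 4 * z\<^sup>2 * T z" using double[of z] z by simp
        also have "cut_moment z \<le> K * (z\<^sup>2 * T z)" using Suc.IH z by blast
        finally have "cut_moment y \<le> (K + 4) * z\<^sup>2 * T z" by (simp add: algebra_simps)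
        also have "\<dots> \<le> (K + 4) * z\<^sup>2 * (3 * T y)"
          using y0(2)[of z] z K by (intro mult_left_mono) auto
        also have "\<dots> = (3 / 4 * (K + 4)) * (y\<^sup>2 * T y)" using z by (simp add: power2_eq_square)
        also have "\<dots> \<le> K * (y\<^sup>2 * T y)" using K T_pos[of y] by (intro mult_right_mono) (auto simp: less_imp_le)
        finally show ?thesis .
      qed
    qed
  qed
  have "cut_moment y \<le> K * (y\<^sup>2 * T y)" if "y \<ge> y0" for y
  proof -
    obtain n where "y / y0 < 2 ^ n" using real_arch_pow[of 2 "y / y0"] by auto
    then have "y \<le> 2 ^ n * y0" using y0(1) by (simp add: pos_divide_less_eq less_imp_le)
    also have "\<dots> \<le> 2 ^ Suc n * y0" using y0(1) by simp
    finally show ?thesis using dyadic[of n] that by blast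
  qed
  then show ?thesis using K by (intro exI[of _ K]) (auto simp: eventually_at_top_linorder)
qed

text \<open>
  Iterating \<open>E[(X - x)\<^sup>+] \<ge> x * T (2 * x) + E[(X - 2 * x)\<^sup>+]\<close>.
\<close>

lemma tail_mean_lower:
  assumes "0 < x"
  shows "(\<Sum>j<J. 2 ^ j * x * T (2 ^ Suc j * x)) \<le> tail_mean x"
proof -
  define m where "m x = (\<integral>k. (real_of_int k - x) * indicator {k. x < real_of_int k} k \<partial>\<mu>)" for x
  have int: "integrable (measure_pmf \<mu>) (\<lambda>k. (real_of_int k - x) * indicator {k. x < real_of_int k} k)" for x
    unfolding left_diff_distrib
    by (intro Bochner_Integration.integrable_diff integrable_cut integrable_mult_right
        measure_pmf.integrable_const_bound[where B=1]) (auto simp: indicator_def)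
  have m_nonneg: "0 \<le> m x" for x
    unfolding m_def by (rule Bochner_Integration.integral_nonneg) (auto simp: indicator_def)
  have m_le: "m x \<le> tail_mean x" if "0 < x" for x
    unfolding m_def tail_mean_def
    by (rule integral_mono_pointwise) (intro int integrables | use that in \<open>auto simp: indicator_def\<close>)+
  have m_double: "x * T (2 * x) + m (2 * x) \<le> m x" if "0 < x" for x
  proof -
    have "x * T (2 * x) + m (2 * x) = (\<integral>k. x * indicator {k. 2 * x \<le> real_of_int k} k +
        (real_of_int k - 2 * x) * indicator {k. 2 * x < real_of_int k} k \<partial>\<mu>)"
      unfolding m_def T_eq
      by (subst Bochner_Integration.integral_add) (intro int integrables | simp)+
    also have "\<dots> \<le> m x"
      unfolding m_def
      by (rule integral_mono_pointwise) (intro int integrables | use that in \<open>auto simp: indicator_def\<close>)+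
    finally show ?thesis .
  qed
  have "(\<Sum>j<J. 2 ^ j * x * T (2 ^ Suc j * x)) + m (2 ^ J * x) \<le> m x"
  proof (induction J)
    case (Suc J)
    then show ?case using m_double[of "2 ^ J * x"] assms by (simp add: mult.assoc)
  qed simp
  then show ?thesis using m_nonneg[of "2 ^ J * x"] m_le[OF assms] by linarith
qed

lemma tail_mean_pos: "0 < x \<Longrightarrow> 0 < tail_mean x"
  using tail_mean_lower[of x 1] T_pos[of "2 * x"] by (auto intro: less_le_trans[rotated])

text \<open>
  Each dyadic block in the lower bound for \<open>tail_mean x\<close> is comparable to \<open>x * T x\<close>, and there are
  arbitrarily many of them.
\<close>

lemma T_negligible:
  assumes "0 < e"
  shows "\<forall>\<^sub>F x in at_top. x * T x \<le> e * tail_mean x"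
proof -
  obtain J :: nat where J: "real J > 3 / e" using reals_Archimedean2 by blast
  then have J0: "J > 0" using assms by (cases J) auto
  have "\<forall>\<^sub>F x in at_top. \<forall>j\<in>{..<J}. (1/3) / 2 ^ j * T x \<le> T (2 ^ Suc j * x)"
    by (intro eventually_ball_finite ballI T_scaled_ge) (auto simp: field_simps)
  moreover have "\<forall>\<^sub>F x :: real in at_top. x > 0" by (rule eventually_gt_at_top)
  ultimately show ?thesis
  proof eventually_elim
    case (elim x)
    have "real J * (x * T x / 3) = (\<Sum>j<J. 2 ^ j * x * ((1/3) / 2 ^ j * T x))" by simp
    also have "\<dots> \<le> (\<Sum>j<J. 2 ^ j * x * T (2 ^ Suc j * x))"
      using elim by (intro sum_mono mult_left_mono) auto
    also have "\<dots> \<le> tail_mean x" using elim by (intro tail_mean_lower) auto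
    finally have *: "real J * (x * T x / 3) \<le> tail_mean x" .
    have "3 \<le> e * real J" using J assms by (simp add: field_simps)
    then have "3 * (x * T x / 3) \<le> (e * real J) * (x * T x / 3)"
      using elim T_pos[of x] by (intro mult_right_mono) auto
    also have "\<dots> = e * (real J * (x * T x / 3))" by simp
    also have "\<dots> \<le> e * tail_mean x" using * assms by (intro mult_left_mono) auto
    finally show ?case by simp
  qed
qed

text \<open>
  Integrates \<open>k \<le> k\<^sup>2 / (2 * t) + t / 2\<close> over the values between \<open>x\<close> and \<open>y\<close>.
\<close>

lemma tail_mean_diff_le:
  assumes "0 < x" "x \<le> y" "0 < t"
  shows "tail_mean x - tail_mean y \<le> cut_moment y / (2 * t) + t / 2 * T x"
proof -
  have "tail_mean x - tail_mean y = (\<integral>k. real_of_int k * indicator {k. x < real_of_int k} k -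
      real_of_int k * indicator {k. y < real_of_int k} k \<partial>\<mu>)"
    unfolding tail_mean_def by (subst Bochner_Integration.integral_diff) (intro integrables | simp)+
  also have "\<dots> \<le> (\<integral>k. (1 / (2 * t)) * ((real_of_int k)\<^sup>2 * indicator {k. real_of_int k \<le> y} k) +
      t / 2 * indicator {k. x \<le> real_of_int k} k \<partial>\<mu>)"
  proof (rule integral_mono_pointwise)
    fix k :: int
    have amgm: "r \<le> (1 / (2 * t)) * r\<^sup>2 + t / 2" for r
    proof -
      have "0 \<le> (r - t)\<^sup>2 / (2 * t)" using assms by simp
      also have "\<dots> = (1 / (2 * t)) * r\<^sup>2 + t / 2 - r"
        using assms by (simp add: power2_eq_square field_simps)
      finally show ?thesis by simp
    qed
    show "real_of_int k * indicator {k. x < real_of_int k} k - real_of_int k * indicator {k. y < real_of_int k} k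
      \<le> (1 / (2 * t)) * ((real_of_int k)\<^sup>2 * indicator {k. real_of_int k \<le> y} k) + t / 2 * indicator {k. x \<le> real_of_int k} k"
      using amgm[of "real_of_int k"] assms by (auto simp: indicator_def)
  qed (intro integrables)+
  also have "\<dots> = cut_moment y / (2 * t) + t / 2 * T x"
    unfolding cut_moment_def T_eq by (subst Bochner_Integration.integral_add) (intro integrables | simp)+
  finally show ?thesis .
qed

lemma tail_mean_slowly_varying:
  assumes C: "1 \<le> C" and e: "0 < e"
  shows "\<forall>\<^sub>F x in at_top. tail_mean x - tail_mean (C * x) \<le> e * tail_mean x"
proof -
  have "\<forall>\<^sub>F x in at_top. x * T x \<le> e / C * tail_mean x" using C e by (intro T_negligible) auto
  moreover have "\<forall>\<^sub>F x :: real in at_top. x > 0" by (rule eventually_gt_at_top)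
  ultimately show ?thesis
  proof eventually_elim
    case (elim x)
    have Cx: "x \<le> C * x" using C elim by simp
    have "tail_mean x - tail_mean (C * x) = (\<integral>k. real_of_int k * indicator {k. x < real_of_int k} k -
      real_of_int k * indicator {k. C * x < real_of_int k} k \<partial>\<mu>)"
      unfolding tail_mean_def by (subst Bochner_Integration.integral_diff) (intro integrables | simp)+
    also have "\<dots> \<le> (\<integral>k. C * x * indicator {k. x \<le> real_of_int k} k \<partial>\<mu>)"
    proof (rule integral_mono_pointwise)
      fix k :: int
      have "0 \<le> C * x" using C elim by simp
      then show "real_of_int k * indicator {k. x < real_of_int k} k - real_of_int k * indicator {k. C * x < real_of_int k} k
        \<le> C * x * indicator {k. x \<le> real_of_int k} k"
        using Cx by (auto simp: indicator_def)
    qed (intro integrables)+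
    also have "\<dots> = C * (x * T x)" by (simp add: T_eq)
    also have "\<dots> \<le> C * (e / C * tail_mean x)" using elim C by (intro mult_left_mono) auto
    finally show ?case using C by simp
  qed
qed

text \<open>
  Regular variation on a finite geometric grid with ratio \<open>1 + d\<close>, together with monotonicity of \<open>T\<close>
  between the grid points.
\<close>

lemma T_uniform:
  assumes c: "0 < c" and e: "0 < e"
  shows "\<forall>\<^sub>F y in at_top. \<forall>s. c \<le> s \<and> s \<le> C \<longrightarrow> \<bar>s * T (s * y) / T y - 1\<bar> \<le> e"
proof -
  \<comment> \<open>chosen such that \<open>(1 + d)\<^sup>2 \<le> 1 + e\<close>: one factor from the grid, one from regular variation\<close>
  define d where "d = min e 1 / 3"
  have d: "0 < d" "(1 + d) * (1 + d) \<le> 1 + e" "(1 - d) / (1 + d) \<ge> 1 - e"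
  proof -
    show d0: "0 < d" using e unfolding d_def by auto
    have d1: "d \<le> 1/3" "3 * d \<le> e" unfolding d_def by auto
    have "(1 + d) * (1 + d) = 1 + 2 * d + d * d" by (simp add: algebra_simps)
    also have "d * d \<le> d * 1" using d0 d1 by (intro mult_left_mono) auto
    finally show "(1 + d) * (1 + d) \<le> 1 + e" using d1 by simp
    have "(1 - 3 * d) * (1 + d) \<le> 1 - d" using d0 by (simp add: algebra_simps)
    then have "1 - 3 * d \<le> (1 - d) / (1 + d)" using d0 by (simp add: pos_le_divide_eq)
    then show "(1 - d) / (1 + d) \<ge> 1 - e" using d1 by linarith
  qed
  define g where "g i = c * (1 + d) ^ i" for i
  have g_pos: "0 < g i" for i unfolding g_def using c d by simp
  have g_Suc: "g (Suc i) = (1 + d) * g i" for i unfolding g_def by simp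
  obtain N where N: "C / c < (1 + d) ^ N" using real_arch_pow[of "1 + d" "C / c"] d by auto
  then have gN: "C \<le> g N" unfolding g_def using c by (simp add: pos_divide_less_eq mult.commute less_imp_le)
  have grid: "\<forall>\<^sub>F y in at_top. \<bar>g i * T (g i * y) / T y - 1\<bar> < d" for i
  proof -
    have "((\<lambda>y. g i * (T (g i * y) / T y)) \<longlongrightarrow> g i * (1 / g i)) at_top"
      by (intro tendsto_intros T_regular g_pos)
    then have "((\<lambda>y. g i * T (g i * y) / T y) \<longlongrightarrow> 1) at_top" using g_pos[of i] by simp
    from tendstoD[OF this d(1)] show ?thesis by (simp add: dist_real_def)
  qed
  have "\<forall>\<^sub>F y in at_top. \<forall>i\<in>{..N}. \<bar>g i * T (g i * y) / T y - 1\<bar> < d"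
    using grid by (intro eventually_ball_finite) auto
  moreover have "\<forall>\<^sub>F y :: real in at_top. y > 0" by (rule eventually_gt_at_top)
  ultimately show ?thesis
  proof eventually_elim
    case (elim y)
    show ?case
    proof (intro allI impI)
      fix s assume s: "c \<le> s \<and> s \<le> C"
      define i where "i = (LEAST i. s \<le> g i)"
      have sg: "s \<le> g i" unfolding i_def by (rule LeastI[of _ N]) (use s gN in auto)
      have iN: "i \<le> N" unfolding i_def by (rule Least_le) (use s gN in auto)
      have Ty: "T y > 0" by (rule T_pos)
      have s0: "s > 0" using s c by simp
      define j where "j = i - 1"
      have jN: "j \<le> N" using iN unfolding j_def by simp
      have gj: "g j \<le> s"
      proof (cases i)
        case 0 then show ?thesis using s by (simp add: j_def g_def)
      next
        case (Suc i')
        then have "\<not> s \<le> g j" unfolding j_def using not_less_Least[of i' "\<lambda>i. s \<le> g i"] i_def by simp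
        then show ?thesis by simp
      qed
      have gij: "g i \<le> (1 + d) * g j"
        using g_pos[of j] d g_Suc[of "i - 1"] by (cases i) (auto simp: j_def)
      have "s * T (s * y) \<le> g i * T (g j * y)"
        using sg gj s0 elim g_pos T_pos by (intro mult_mono T_antimono) (auto simp: less_imp_le)
      also have "\<dots> \<le> (1 + d) * g j * T (g j * y)"
        using gij T_pos by (intro mult_right_mono) (auto simp: less_imp_le)
      finally have "s * T (s * y) / T y \<le> (1 + d) * (g j * T (g j * y) / T y)"
        using Ty by (simp add: divide_right_mono mult.assoc)
      also have "\<dots> \<le> (1 + d) * (1 + d)"
        using elim(1) jN d(1) by (intro mult_left_mono) (auto simp: abs_less_iff dest!: bspec[of _ _ j])
      also note d(2)
      finally have up: "s * T (s * y) / T y \<le> 1 + e" .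
      have "g i * T (g i * y) \<le> (1 + d) * g j * T (s * y)"
        using sg gij s0 elim g_pos T_pos d by (intro mult_mono T_antimono) (auto simp: less_imp_le)
      also have "\<dots> \<le> (1 + d) * s * T (s * y)"
        using gj T_pos d by (intro mult_right_mono mult_left_mono) (auto simp: less_imp_le)
      finally have "g i * T (g i * y) / T y \<le> (1 + d) * (s * T (s * y) / T y)"
        using Ty by (simp add: divide_right_mono mult.assoc)
      moreover have "1 - d \<le> g i * T (g i * y) / T y"
        using elim(1) iN by (auto simp: abs_less_iff dest!: bspec[of _ _ i])
      ultimately have "1 - d \<le> (s * T (s * y) / T y) * (1 + d)" by (simp add: mult.commute)
      then have "(1 - d) / (1 + d) \<le> s * T (s * y) / T y" using d(1) by (simp add: pos_divide_le_eq)
      with d(3) have "1 - e \<le> s * T (s * y) / T y" by linarith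
      with up show "\<bar>s * T (s * y) / T y - 1\<bar> \<le> e" by (simp add: abs_le_iff)
    qed
  qed
qed

end

section \<open>Concentration of truncated sums\<close>

lemma map_replicate_pmf: "map_pmf (map f) (replicate_pmf n p) = replicate_pmf n (map_pmf f p)"
proof (induction n)
  case (Suc n)
  show ?case by (simp add: Suc.IH[symmetric] map_bind_pmf bind_map_pmf)
qed simp

lemma sum_list_moments:
  fixes h :: "'a \<Rightarrow> real"
  assumes fin: "finite (set_pmf p)" and mean: "measure_pmf.expectation p h = 0"
  shows "measure_pmf.expectation (replicate_pmf n p) (\<lambda>xs. \<Sum>x\<leftarrow>xs. h x) = 0 \<and>
    measure_pmf.expectation (replicate_pmf n p) (\<lambda>xs. (\<Sum>x\<leftarrow>xs. h x)\<^sup>2) =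
      real n * measure_pmf.expectation p (\<lambda>x. (h x)\<^sup>2)"
proof (induction n)
  case (Suc n)
  let ?R = "replicate_pmf n p"
  have finR: "finite (set_pmf ?R)"
    using finite_lists_length_eq[OF fin, of n] by (simp add: set_replicate_pmf lists_eq_set Collect_conj_eq)
  have int [simp]: "integrable (measure_pmf ?R) g" for g :: "_ \<Rightarrow> real"
    by (rule integrable_measure_pmf_finite[OF finR])
  have E: "measure_pmf.expectation p f = (\<Sum>a\<in>set_pmf p. pmf p a * f a)" for f :: "_ \<Rightarrow> real"
    by (subst integral_measure_pmf[OF fin]) auto
  have cons: "measure_pmf.expectation (replicate_pmf (Suc n) p) g =
      (\<Sum>a\<in>set_pmf p. pmf p a * measure_pmf.expectation ?R (\<lambda>xs. g (a # xs)))" for g :: "_ \<Rightarrow> real"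
    unfolding replicate_pmf.simps map_pmf_def[symmetric]
    by (subst pmf_expectation_bind[OF fin]) (auto simp: finR)
  have "measure_pmf.expectation (replicate_pmf (Suc n) p) (\<lambda>xs. \<Sum>x\<leftarrow>xs. h x) =
      (\<Sum>a\<in>set_pmf p. pmf p a * h a)"
    unfolding cons using Suc.IH by simp
  also have "\<dots> = 0" using mean by (simp add: E)
  finally have 1: "measure_pmf.expectation (replicate_pmf (Suc n) p) (\<lambda>xs. \<Sum>x\<leftarrow>xs. h x) = 0" .
  have sq: "measure_pmf.expectation ?R (\<lambda>xs. (\<Sum>x\<leftarrow>a # xs. h x)\<^sup>2) =
      (h a)\<^sup>2 + real n * measure_pmf.expectation p (\<lambda>x. (h x)\<^sup>2)" for a
    using Suc.IH by (simp add: power2_sum Bochner_Integration.integral_add algebra_simps)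
  have "measure_pmf.expectation (replicate_pmf (Suc n) p) (\<lambda>xs. (\<Sum>x\<leftarrow>xs. h x)\<^sup>2) =
      (\<Sum>a\<in>set_pmf p. pmf p a * ((h a)\<^sup>2 + real n * measure_pmf.expectation p (\<lambda>x. (h x)\<^sup>2)))"
    unfolding cons sq ..
  also have "\<dots> = (\<Sum>a\<in>set_pmf p. pmf p a * (h a)\<^sup>2) +
      (\<Sum>a\<in>set_pmf p. pmf p a) * (real n * measure_pmf.expectation p (\<lambda>x. (h x)\<^sup>2))"
    by (simp add: distrib_left sum.distrib sum_distrib_right)
  also have "\<dots> = real (Suc n) * measure_pmf.expectation p (\<lambda>x. (h x)\<^sup>2)"
    using sum_pmf_eq_1[OF fin, of p] by (simp add: E algebra_simps)
  finally show ?case using 1 by blast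
qed simp

lemma chebyshev_sum_list:
  fixes g :: "'a \<Rightarrow> real"
  assumes fin: "finite (set_pmf p)" and t: "0 < t"
  shows "measure_pmf.prob (replicate_pmf n p)
      {xs. t \<le> \<bar>(\<Sum>x\<leftarrow>xs. g x) - real n * measure_pmf.expectation p g\<bar>} \<le>
    real n * measure_pmf.expectation p (\<lambda>x. (g x)\<^sup>2) / t\<^sup>2"
proof -
  define m where "m = measure_pmf.expectation p g"
  define h where "h x = g x - m" for x
  let ?R = "replicate_pmf n p"
  have finR: "finite (set_pmf ?R)"
    using finite_lists_length_eq[OF fin, of n] by (simp add: set_replicate_pmf lists_eq_set Collect_conj_eq)
  have int [simp]: "integrable (measure_pmf ?R) g" for g :: "_ \<Rightarrow> real"
    by (rule integrable_measure_pmf_finite[OF finR])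
  have int' [simp]: "integrable (measure_pmf p) g" for g :: "_ \<Rightarrow> real"
    by (rule integrable_measure_pmf_finite[OF fin])
  have h0: "measure_pmf.expectation p h = 0"
    unfolding h_def[abs_def] by (simp add: m_def)
  have sum_h: "(\<Sum>x\<leftarrow>xs. h x) = (\<Sum>x\<leftarrow>xs. g x) - real n * m" if "length xs = n" for xs
    using that by (induction xs arbitrary: n) (auto simp: h_def algebra_simps)
  have mean: "measure_pmf.expectation ?R (\<lambda>xs. \<Sum>x\<leftarrow>xs. h x) = 0"
    and var: "measure_pmf.expectation ?R (\<lambda>xs. (\<Sum>x\<leftarrow>xs. h x)\<^sup>2) = real n * measure_pmf.expectation p (\<lambda>x. (h x)\<^sup>2)"
    using sum_list_moments[OF fin h0] by blast+
  have "measure_pmf.prob ?R {xs. t \<le> \<bar>(\<Sum>x\<leftarrow>xs. g x) - real n * m\<bar>} =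
      measure_pmf.prob ?R {xs. t \<le> \<bar>\<Sum>x\<leftarrow>xs. h x\<bar>}"
    by (rule measure_pmf.finite_measure_eq_AE)
      (auto simp: AE_measure_pmf_iff sum_h dest!: length_replicate_pmf)
  also have "\<dots> \<le> real n * measure_pmf.expectation p (\<lambda>x. (h x)\<^sup>2) / t\<^sup>2"
    using measure_pmf.Chebyshev_inequality[of "\<lambda>xs. \<Sum>x\<leftarrow>xs. h x" ?R t] t by (simp add: mean var)
  also have "measure_pmf.expectation p (\<lambda>x. (h x)\<^sup>2) = measure_pmf.expectation p (\<lambda>x. (g x)\<^sup>2) - m\<^sup>2"
  proof -
    have "measure_pmf.expectation p (\<lambda>x. (h x)\<^sup>2) = measure_pmf.expectation p (\<lambda>x. (g x)\<^sup>2 - 2 * m * g x + m\<^sup>2)"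
      by (simp add: h_def power2_diff algebra_simps)
    also have "\<dots> = measure_pmf.expectation p (\<lambda>x. (g x)\<^sup>2) - m\<^sup>2"
      by (simp add: m_def[symmetric] power2_eq_square)
    finally show ?thesis .
  qed
  also have "real n * (measure_pmf.expectation p (\<lambda>x. (g x)\<^sup>2) - m\<^sup>2) / t\<^sup>2 \<le>
      real n * measure_pmf.expectation p (\<lambda>x. (g x)\<^sup>2) / t\<^sup>2"
    by (intro divide_right_mono mult_left_mono) auto
  finally show ?thesis unfolding m_def .
qed

context cauchy_walk begin

definition cut :: "real \<Rightarrow> int \<Rightarrow> int" where
  "cut y k = (if real_of_int k \<le> y then k else 0)"

abbreviation cut_sum :: "real \<Rightarrow> int list \<Rightarrow> real" where
  "cut_sum y xs \<equiv> (\<Sum>x\<leftarrow>xs. real_of_int (cut y x))"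

lemma expectation_cut: "(\<integral>k. real_of_int (cut y k) \<partial>\<mu>) = - tail_mean y"
proof -
  have "(\<integral>k. real_of_int (cut y k) \<partial>\<mu>) =
      (\<integral>k. real_of_int k - real_of_int k * indicator {k. y < real_of_int k} k \<partial>\<mu>)"
    by (intro Bochner_Integration.integral_cong) (auto simp: cut_def indicator_def)
  also have "\<dots> = - tail_mean y"
    unfolding tail_mean_def by (subst Bochner_Integration.integral_diff) (auto simp: mean_zero intro!: integrables)
  finally show ?thesis .
qed

lemma cut_sum_concentration:
  assumes t: "0 < t"
  shows "pr n (\<lambda>xs. t \<le> \<bar>cut_sum y xs + real n * tail_mean y\<bar>) \<le> real n * cut_moment y / t\<^sup>2"
proof -
  let ?q = "map_pmf (cut y) \<mu>"
  have "set_pmf ?q \<subseteq> {-1..max 0 \<lfloor>y\<rfloor>}"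
    using step_ge by (auto simp: cut_def le_floor_iff le_max_iff_disj)
  then have fin: "finite (set_pmf ?q)" by (rule finite_subset) simp
  have "pr n (\<lambda>xs. t \<le> \<bar>cut_sum y xs + real n * tail_mean y\<bar>) =
      measure_pmf.prob (replicate_pmf n ?q)
        {xs. t \<le> \<bar>(\<Sum>x\<leftarrow>xs. real_of_int x) - real n * measure_pmf.expectation ?q real_of_int\<bar>}"
    by (simp add: map_replicate_pmf[symmetric] vimage_def expectation_cut o_def)
  also have "\<dots> \<le> real n * measure_pmf.expectation ?q (\<lambda>x. (real_of_int x)\<^sup>2) / t\<^sup>2"
    by (rule chebyshev_sum_list[OF fin t])
  also have "measure_pmf.expectation ?q (\<lambda>x. (real_of_int x)\<^sup>2) = cut_moment y"
    unfolding cut_moment_def by (auto intro!: Bochner_Integration.integral_cong simp: cut_def indicator_def)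
  finally show ?thesis .
qed

lemma pr_hd_tl:
  "pr (Suc n) (\<lambda>xs. A (hd xs) \<and> B (tl xs)) = measure_pmf.prob \<mu> {x. A x} * pr n B"
proof -
  have "pr (Suc n) (\<lambda>xs. A (hd xs) \<and> B (tl xs)) =
      measure_pmf.prob (pair_pmf \<mu> (replicate_pmf n \<mu>)) ({x. A x} \<times> {xs. B xs})"
    unfolding replicate_pmf_Suc_pair
    by (auto simp: case_prod_unfold intro!: arg_cong[of _ _ "measure_pmf.prob _"])
  also have "\<dots> = measure_pmf.prob \<mu> {x. A x} * pr n B" by (rule measure_pmf_prob_product) auto
  finally show ?thesis .
qed

lemma pr_hd: "0 < n \<Longrightarrow> pr n (\<lambda>xs. A (hd xs)) = measure_pmf.prob \<mu> {x. A x}"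
  using pr_hd_tl[of "n - 1" A "\<lambda>_. True"] measure_pmf.prob_space[of "replicate_pmf (n - 1) \<mu>"]
  by (cases n) (simp_all del: replicate_pmf.simps)

lemma pr_exists_large_le: "pr n (\<lambda>xs. \<exists>x\<in>set xs. z \<le> real_of_int x) \<le> real n * T z"
proof (cases "n = 0")
  case False
  have "pr n (\<lambda>xs. (\<exists>x\<in>set xs. z \<le> real_of_int x) \<and> True) \<le>
      real n * pr n (\<lambda>xs. z \<le> real_of_int (hd xs) \<and> True)"
    by (rule prob_exists_le) simp
  then show ?thesis using False pr_hd[of n "\<lambda>x. z \<le> real_of_int x"] by (simp add: T_def)
qed simp

lemma pr_two_large_le:
  "pr n (\<lambda>xs. 2 \<le> length (filter (\<lambda>x. y \<le> real_of_int x) xs)) \<le> (real n * T y)\<^sup>2"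
proof (cases n)
  case (Suc m)
  let ?F = "filter (\<lambda>x. y \<le> real_of_int x)"
  have len: "length (?F (rotate1 xs)) = length (?F xs)" for xs by (cases xs) auto
  have "pr n (\<lambda>xs. 2 \<le> length (?F xs)) \<le> pr n (\<lambda>xs. (\<exists>x\<in>set xs. y \<le> real_of_int x) \<and> 2 \<le> length (?F xs))"
  proof (rule pr_mono)
    fix xs assume F: "2 \<le> length (?F xs)"
    then have "?F xs \<noteq> []" by auto
    then show "(\<exists>x\<in>set xs. y \<le> real_of_int x) \<and> 2 \<le> length (?F xs)"
      using F by (auto simp: filter_empty_conv)
  qed
  also have "\<dots> \<le> real n * pr n (\<lambda>xs. y \<le> real_of_int (hd xs) \<and> 2 \<le> length (?F xs))"
    by (rule prob_exists_le) (simp add: len)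
  also have "pr n (\<lambda>xs. y \<le> real_of_int (hd xs) \<and> 2 \<le> length (?F xs)) \<le>
      pr n (\<lambda>xs. y \<le> real_of_int (hd xs) \<and> (\<exists>x\<in>set (tl xs). y \<le> real_of_int x))"
  proof (rule pr_mono)
    fix xs assume l: "length xs = n" and h: "y \<le> real_of_int (hd xs) \<and> 2 \<le> length (?F xs)"
    then obtain a ys where xs: "xs = a # ys" using Suc by (cases xs) auto
    then have "?F ys \<noteq> []" using h by auto
    then show "y \<le> real_of_int (hd xs) \<and> (\<exists>x\<in>set (tl xs). y \<le> real_of_int x)"
      using h xs by (auto simp: filter_empty_conv)
  qed
  also have "\<dots> = T y * pr m (\<lambda>xs. \<exists>x\<in>set xs. y \<le> real_of_int x)"
    unfolding Suc T_def by (rule pr_hd_tl)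
  also have "\<dots> \<le> T y * (real m * T y)" using T_pos[of y] by (intro mult_left_mono pr_exists_large_le) auto
  also have "real n * (T y * (real m * T y)) = real n * real m * (T y)\<^sup>2" by (simp add: power2_eq_square)
  also have "\<dots> \<le> real n * real n * (T y)\<^sup>2" using Suc by (intro mult_right_mono mult_left_mono) auto
  finally have "pr n (\<lambda>xs. 2 \<le> length (?F xs)) \<le> real n * real n * (T y)\<^sup>2" by (simp add: mult_left_mono)
  then show ?thesis by (simp add: power2_eq_square mult_ac)
qed simp

text \<open>
  The complement has probability \<open>(1 - T z) ^ n\<close>, which is at most \<open>1 / (1 + T z) ^ n\<close>; Bernoulli's
  inequality bounds the latter.
\<close>

lemma pr_exists_large_ge:
  assumes n: "0 < n"
  shows "real n * T z / (1 + real n * T z) \<le> pr n (\<lambda>xs. \<exists>x\<in>set xs. z \<le> real_of_int x)"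
proof -
  have none: "pr n (\<lambda>xs. \<forall>x\<in>set xs. real_of_int x < z) = (1 - T z) ^ n" for n
  proof (induction n)
    case (Suc n)
    have "pr (Suc n) (\<lambda>xs. \<forall>x\<in>set xs. real_of_int x < z) =
        pr (Suc n) (\<lambda>xs. real_of_int (hd xs) < z \<and> (\<forall>x\<in>set (tl xs). real_of_int x < z))"
      by (rule pr_cong) (auto simp: length_Suc_conv)
    also have "\<dots> = measure_pmf.prob \<mu> {x. real_of_int x < z} * pr n (\<lambda>xs. \<forall>x\<in>set xs. real_of_int x < z)"
      by (rule pr_hd_tl)
    also have "measure_pmf.prob \<mu> {x. real_of_int x < z} = 1 - T z"
    proof -
      have "{x. real_of_int x < z} = UNIV - {x. z \<le> real_of_int x}" by auto
      then show ?thesis unfolding T_def using measure_pmf.prob_compl[of "{x. z \<le> real_of_int x}" \<mu>] by simp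
    qed
    finally show ?case using Suc.IH by simp
  qed simp
  have "pr n (\<lambda>xs. \<exists>x\<in>set xs. z \<le> real_of_int x) = 1 - pr n (\<lambda>xs. \<forall>x\<in>set xs. real_of_int x < z)"
  proof -
    have "{xs. \<exists>x\<in>set xs. z \<le> real_of_int x} = UNIV - {xs. \<forall>x\<in>set xs. real_of_int x < z}" by force
    then show ?thesis
      using measure_pmf.prob_compl[of "{xs. \<forall>x\<in>set xs. real_of_int x < z}" "replicate_pmf n \<mu>"] by simp
  qed
  also have "\<dots> = 1 - (1 - T z) ^ n" unfolding none ..
  finally have eq: "pr n (\<lambda>xs. \<exists>x\<in>set xs. z \<le> real_of_int x) = 1 - (1 - T z) ^ n" .
  have T: "0 < T z" "T z \<le> 1" using T_pos T_le_1 by auto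
  have "(1 - T z) ^ n * (1 + real n * T z) \<le> (1 - T z) ^ n * (1 + T z) ^ n"
    using T Bernoulli_inequality[of "T z" n] by (intro mult_left_mono) auto
  also have "\<dots> = (1 - (T z)\<^sup>2) ^ n"
    by (simp add: power_mult_distrib[symmetric] power2_eq_square algebra_simps)
  also have "\<dots> \<le> 1" using T by (intro power_le_one) (auto simp: power_le_one)
  finally have "(1 - T z) ^ n \<le> 1 / (1 + real n * T z)" using T by (simp add: pos_le_divide_eq add_pos_nonneg)
  also have "1 / (1 + real n * T z) = 1 - real n * T z / (1 + real n * T z)"
  proof -
    have "1 + real n * T z \<noteq> 0" using T by (smt (verit) mult_nonneg_nonneg of_nat_0_le_iff)
    then show ?thesis by (simp add: field_simps)
  qed
  finally show ?thesis unfolding eq by simp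
qed

lemma cut_sum_rotate1: "cut_sum y (rotate1 xs) = cut_sum y xs"
  by (cases xs) auto

text \<open>
  If no step reaches \<open>z\<close> and at most one exceeds \<open>y\<close>, a path ending above 0 has a sum of steps truncated
  at \<open>y\<close> of at least \<open>-z\<close>, that is, at least \<open>t\<close> above its mean \<open>- n * tail_mean y\<close>.
\<close>

lemma end_nonneg_upper:
  assumes y: "0 < y" and z: "0 < z" and t: "0 < t" "t \<le> real n * tail_mean y - z"
  shows "end_nonneg n \<le> real n * T z + (real n * T y)\<^sup>2 + real n * cut_moment y / t\<^sup>2"
proof -
  let ?big = "\<lambda>xs. \<exists>x\<in>set xs. z \<le> real_of_int x"
  let ?two = "\<lambda>xs. 2 \<le> length (filter (\<lambda>x. y \<le> real_of_int x) xs)"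
  let ?dev = "\<lambda>xs. t \<le> \<bar>cut_sum y xs + real n * tail_mean y\<bar>"
  have le: "real_of_int (sum_list xs) \<le> cut_sum y xs + z * real (length (filter (\<lambda>x. y \<le> real_of_int x) xs))"
    if "\<not> ?big xs" for xs
    using that by (induction xs) (use z in \<open>auto simp: cut_def algebra_simps\<close>)
  have "end_nonneg n \<le> pr n (\<lambda>xs. ?big xs \<or> ?two xs \<or> ?dev xs)"
    unfolding end_nonneg_def
  proof (rule pr_mono)
    fix xs :: "int list" assume nn: "0 \<le> sum_list xs"
    show "?big xs \<or> ?two xs \<or> ?dev xs"
    proof (cases "?big xs \<or> ?two xs")
      case False
      then have "z * real (length (filter (\<lambda>x. y \<le> real_of_int x) xs)) \<le> z * 1"
        using z by (intro mult_left_mono) auto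
      moreover have "0 \<le> cut_sum y xs + z * real (length (filter (\<lambda>x. y \<le> real_of_int x) xs))"
        using le[of xs] False nn by linarith
      ultimately have "- z \<le> cut_sum y xs" by linarith
      then show ?thesis using t by linarith
    qed blast
  qed
  also have "{xs. ?big xs \<or> ?two xs \<or> ?dev xs} = {xs. ?big xs} \<union> ({xs. ?two xs} \<union> {xs. ?dev xs})" by auto
  also have "measure_pmf.prob (replicate_pmf n \<mu>) ({xs. ?big xs} \<union> ({xs. ?two xs} \<union> {xs. ?dev xs})) \<le>
      pr n ?big + (pr n ?two + pr n ?dev)"
    by (intro order.trans[OF measure_Un_le] add_left_mono measure_Un_le) auto
  also have "\<dots> \<le> real n * T z + ((real n * T y)\<^sup>2 + real n * cut_moment y / t\<^sup>2)"
    by (intro add_mono pr_exists_large_le pr_two_large_le cut_sum_concentration t)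
  finally show ?thesis by simp
qed

text \<open>
  A step of size \<open>z\<close> brings the walk above 0 unless the sum of the steps truncated at \<open>y < z\<close> is below
  \<open>-z\<close>. The large step does not contribute to the truncated sum, so the two events are almost
  independent.
\<close>

lemma end_nonneg_lower:
  assumes y: "0 \<le> y" "y < z" and t: "0 < t" "t \<le> z - real n * tail_mean y" and n: "0 < n"
  shows "real n * T z / (1 + real n * T z) - real n * T z * (real n * cut_moment y / t\<^sup>2) \<le> end_nonneg n"
proof -
  let ?big = "\<lambda>xs. \<exists>x\<in>set xs. z \<le> real_of_int x"
  let ?low = "\<lambda>xs. cut_sum y xs < - z"
  have ge: "cut_sum y xs \<le> real_of_int (sum_list xs)" for xs
    using y by (induction xs) (auto simp: cut_def intro: order_trans[rotated])
  have big_ge: "cut_sum y xs + z \<le> real_of_int (sum_list xs)" if "?big xs" for xs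
    using that
  proof (induction xs)
    case (Cons a xs)
    show ?case
    proof (cases "z \<le> real_of_int a")
      case True
      then show ?thesis using ge[of xs] y by (auto simp: cut_def)
    next
      case False
      then have "cut_sum y xs + z \<le> real_of_int (sum_list xs)" using Cons by auto
      then show ?thesis using y by (auto simp: cut_def)
    qed
  qed simp
  obtain m where m: "n = Suc m" using n by (cases n) auto
  have ell0: "0 \<le> tail_mean y"
    unfolding tail_mean_def by (rule Bochner_Integration.integral_nonneg) (use y in \<open>auto simp: indicator_def\<close>)
  have "pr n ?big \<le> pr n (\<lambda>xs. 0 \<le> sum_list xs \<or> (?big xs \<and> ?low xs))"
  proof (rule pr_mono)
    fix xs assume b: "?big xs"
    show "0 \<le> sum_list xs \<or> (?big xs \<and> ?low xs)" using big_ge[OF b] b by linarith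
  qed
  also have "{xs. 0 \<le> sum_list xs \<or> (?big xs \<and> ?low xs)} = {xs. 0 \<le> sum_list xs} \<union> {xs. ?big xs \<and> ?low xs}" by auto
  also have "measure_pmf.prob (replicate_pmf n \<mu>) \<dots> \<le> end_nonneg n + pr n (\<lambda>xs. ?big xs \<and> ?low xs)"
    unfolding end_nonneg_def by (rule measure_Un_le) auto
  also have "pr n (\<lambda>xs. ?big xs \<and> ?low xs) \<le> real n * pr n (\<lambda>xs. z \<le> real_of_int (hd xs) \<and> ?low xs)"
    by (rule prob_exists_le) (simp only: cut_sum_rotate1)
  also have "pr n (\<lambda>xs. z \<le> real_of_int (hd xs) \<and> ?low xs) = pr n (\<lambda>xs. z \<le> real_of_int (hd xs) \<and> ?low (tl xs))"
    by (rule pr_cong) (use y in \<open>auto simp: m length_Suc_conv cut_def\<close>)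
  also have "\<dots> = T z * pr m ?low"
    unfolding m T_def by (rule pr_hd_tl)
  also have "pr m ?low \<le> pr m (\<lambda>xs. t \<le> \<bar>cut_sum y xs + real m * tail_mean y\<bar>)"
  proof (rule pr_mono)
    fix xs assume "?low xs"
    moreover have "real m * tail_mean y \<le> real n * tail_mean y" using ell0 m by (intro mult_right_mono) auto
    ultimately show "t \<le> \<bar>cut_sum y xs + real m * tail_mean y\<bar>" using t by linarith
  qed
  also have "\<dots> \<le> real m * cut_moment y / t\<^sup>2" by (rule cut_sum_concentration[OF t(1)])
  also have "\<dots> \<le> real n * cut_moment y / t\<^sup>2"
    using cut_moment_nonneg m by (intro divide_right_mono mult_right_mono) auto
  finally have "pr n ?big \<le> end_nonneg n + real n * (T z * (real n * cut_moment y / t\<^sup>2))"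
    using T_pos[of z] by (simp add: mult_left_mono)
  then show ?thesis using pr_exists_large_ge[OF n, of z] by (simp add: mult.assoc)
qed

end

section \<open>One big jump\<close>

text \<open>
  On average about one of \<open>n\<close> steps reaches \<open>a n\<close>, which is thus the order of magnitude of the largest
  step.
\<close>

locale scaled_cauchy_walk = cauchy_walk +
  fixes a :: "nat \<Rightarrow> real"
  assumes a_tail: "(\<lambda>n. real n * T (a n)) \<longlonglongrightarrow> 1"
begin

text \<open>
  This is \<open>\<bar>b n\<bar>\<close> for large \<open>n\<close>, the distance by which the walk falls below 0 in \<open>n\<close> steps that are not
  larger than the scale.
\<close>

definition drift :: "nat \<Rightarrow> real" where "drift n = real n * tail_mean (a n)"
text \<open>
  The expected number of steps that can undo the drift.
\<close>

definition big_jump :: "nat \<Rightarrow> real" where "big_jump n = real n * T (drift n)"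

lemma nTa_bounds:
  assumes "0 < e"
  shows "\<forall>\<^sub>F n in sequentially. 1 - e \<le> real n * T (a n) \<and> real n * T (a n) \<le> 1 + e"
  using tendstoD[OF a_tail assms] by eventually_elim (auto simp: dist_real_def)

lemma a_top: "filterlim a at_top sequentially"
  unfolding filterlim_at_top
proof
  fix Z
  have "\<forall>\<^sub>F n in sequentially. 2 / T Z < real n" by real_asymp
  then show "\<forall>\<^sub>F n in sequentially. Z \<le> a n"
    using nTa_bounds[of 1, simplified]
  proof eventually_elim
    case (elim n)
    show ?case
    proof (rule ccontr)
      assume "\<not> Z \<le> a n"
      then have "T Z \<le> T (a n)" by (intro T_antimono) simp
      then have "real n * T Z \<le> real n * T (a n)" by (intro mult_left_mono) auto
      moreover have "2 < real n * T Z" using elim(1) T_pos[of Z] by (simp add: pos_divide_less_eq)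
      ultimately show False using elim by linarith
    qed
  qed
qed

lemmas at_a = eventually_compose_filterlim[OF _ a_top]

lemma drift_large:
  assumes K: "0 < K"
  shows "\<forall>\<^sub>F n in sequentially. K * a n \<le> drift n"
proof -
  have "\<forall>\<^sub>F n in sequentially. a n * T (a n) \<le> 1 / (2 * K) * tail_mean (a n)"
    by (intro at_a T_negligible) (use K in auto)
  moreover have "\<forall>\<^sub>F n in sequentially. 0 < a n" by (intro at_a eventually_gt_at_top)
  ultimately show ?thesis using nTa_bounds[of "1/2", simplified]
  proof eventually_elim
    case (elim n)
    have "K * (a n * T (a n)) \<le> K * (1 / (2 * K) * tail_mean (a n))" using elim K by (intro mult_left_mono) auto
    also have "\<dots> = 1 / 2 * tail_mean (a n)" using K by simp
    also have "\<dots> \<le> (real n * T (a n)) * tail_mean (a n)"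
      using elim tail_mean_pos[of "a n"] by (intro mult_right_mono) auto
    finally have "(K * a n) * T (a n) \<le> drift n * T (a n)" by (simp add: drift_def mult_ac)
    then show ?case using T_pos[of "a n"] by simp
  qed
qed

lemma drift_top: "filterlim drift at_top sequentially"
  by (rule filterlim_at_top_mono[OF a_top]) (use drift_large[of 1] in simp)

lemmas at_drift = eventually_compose_filterlim[OF _ drift_top]

lemma T_drift_negligible:
  assumes e: "0 < e"
  shows "\<forall>\<^sub>F n in sequentially. T (drift n) \<le> e * T (a n)"
proof -
  have "\<forall>\<^sub>F n in sequentially. T (2 / e * a n) \<le> e * T (a n)"
    by (rule at_a[OF T_scaled_le]) (use e in auto)
  moreover have "\<forall>\<^sub>F n in sequentially. 2 / e * a n \<le> drift n" by (rule drift_large) (use e in auto)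
  ultimately show ?thesis
    by eventually_elim (use T_antimono order_trans in blast)
qed

text \<open>
  Write \<open>B\<close> for \<open>drift n\<close>. With \<open>t = h * B\<close> the first term of the bound for
  \<open>tail_mean (a n) - tail_mean B\<close> is of order \<open>B * T B / h\<close>, negligible against \<open>B * T (a n)\<close> since
  \<open>B\<close> is much larger than \<open>a n\<close>. The second is \<open>h / 2 * B * T (a n)\<close>, of order
  \<open>h * tail_mean (a n)\<close> because \<open>n * T (a n)\<close> is about 1.
\<close>

lemma tail_mean_drift:
  assumes e: "0 < e"
  shows "\<forall>\<^sub>F n in sequentially. (1 - e) * drift n \<le> real n * tail_mean (drift n)"
proof -
  obtain K where K: "K > 0" and cut_moment: "\<forall>\<^sub>F y in at_top. cut_moment y \<le> K * (y\<^sup>2 * T y)" using cut_moment_le by blast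
  define h where "h = e / 2"
  have h: "0 < h" using e unfolding h_def by simp
  have "\<forall>\<^sub>F n in sequentially. T (drift n) \<le> h\<^sup>2 / K * T (a n)" using h K by (intro T_drift_negligible) auto
  moreover have "\<forall>\<^sub>F n in sequentially. cut_moment (drift n) \<le> K * ((drift n)\<^sup>2 * T (drift n))" by (rule at_drift[OF cut_moment])
  moreover have "\<forall>\<^sub>F n in sequentially. 0 < a n" by (intro at_a eventually_gt_at_top)
  moreover have "\<forall>\<^sub>F n in sequentially. 1 * a n \<le> drift n" by (rule drift_large) auto
  ultimately show ?thesis using nTa_bounds[of 1, simplified]
  proof eventually_elim
    case (elim n)
    let ?B = "drift n" and ?a = "a n"
    have drift: "0 < ?B" "?a \<le> ?B" using elim by auto
    have tail_mean: "0 < tail_mean ?a" using elim tail_mean_pos by simp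
    have "tail_mean ?a - tail_mean ?B \<le> cut_moment ?B / (2 * (h * ?B)) + h * ?B / 2 * T ?a"
      using tail_mean_diff_le[of ?a ?B "h * ?B"] elim drift h by simp
    also have "cut_moment ?B / (2 * (h * ?B)) \<le> K * (?B\<^sup>2 * T ?B) / (2 * (h * ?B))"
      using elim drift h by (intro divide_right_mono) auto
    also have "\<dots> = K * ?B / (2 * h) * T ?B" using drift h by (simp add: power2_eq_square field_simps)
    also have "\<dots> \<le> K * ?B / (2 * h) * (h\<^sup>2 / K * T ?a)" using elim drift h K by (intro mult_left_mono) auto
    also have "\<dots> = h * ?B / 2 * T ?a" using h K by (simp add: power2_eq_square field_simps)
    finally have "tail_mean ?a - tail_mean ?B \<le> h * (?B * T ?a)" by (simp add: mult_ac)
    also have "?B * T ?a = (real n * T ?a) * tail_mean ?a" by (simp add: drift_def)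
    also have "h * ((real n * T ?a) * tail_mean ?a) \<le> h * (2 * tail_mean ?a)"
      using elim h tail_mean by (intro mult_left_mono mult_right_mono) auto
    finally have "tail_mean ?a - tail_mean ?B \<le> e * tail_mean ?a" unfolding h_def by simp
    then have "real n * ((1 - e) * tail_mean ?a) \<le> real n * tail_mean ?B" by (intro mult_left_mono) (auto simp: algebra_simps)
    then show ?case by (simp add: drift_def mult_ac)
  qed
qed

lemma big_jump_pos: "0 < n \<Longrightarrow> 0 < big_jump n"
  unfolding big_jump_def using T_pos by simp

lemma big_jump_small:
  assumes e: "0 < e"
  shows "\<forall>\<^sub>F n in sequentially. big_jump n \<le> e"
proof -
  have "\<forall>\<^sub>F n in sequentially. T (drift n) \<le> e / 2 * T (a n)" using e by (intro T_drift_negligible) simp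
  then show ?thesis using nTa_bounds[of 1, simplified]
  proof eventually_elim
    case (elim n)
    have "big_jump n \<le> real n * (e / 2 * T (a n))" unfolding big_jump_def using elim by (intro mult_left_mono) auto
    also have "\<dots> = e / 2 * (real n * T (a n))" by simp
    also have "\<dots> \<le> e / 2 * 2" using elim e by (intro mult_left_mono) auto
    finally show ?case by simp
  qed
qed

text \<open>
  For \<open>k\<close> between \<open>n / 2\<close> and \<open>n\<close> the tails at \<open>a k\<close> and \<open>a n\<close> differ by a factor at most about 2, so
  \<open>a k\<close> lies between \<open>a n / 3\<close> and \<open>2 * a n\<close>, and \<open>tail_mean\<close> is slowly varying.
\<close>

lemma tail_mean_a_comparable:
  assumes e: "0 < e" "e \<le> 1/2"
  shows "\<forall>\<^sub>F n in sequentially. \<forall>k\<le>n. n \<le> 2 * k \<longrightarrow>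
    (1 - e) * tail_mean (a n) \<le> tail_mean (a k) \<and> tail_mean (a k) \<le> (1 + 2 * e) * tail_mean (a n)"
proof -
  \<comment> \<open>then \<open>T (a k) / T (a n)\<close> lies between \<open>9 / 11\<close> and \<open>22 / 9\<close>, strictly inside the interval from \<open>6 / 10\<close> to \<open>29 / 10\<close>\<close>
  obtain N where N: "\<And>n. N \<le> n \<Longrightarrow> 9/10 \<le> real n * T (a n) \<and> real n * T (a n) \<le> 11/10"
    using nTa_bounds[of "1/10"] unfolding eventually_sequentially by auto
  have "\<forall>\<^sub>F n in sequentially. T (2 * a n) \<le> 6/10 * T (a n)"
    by (rule at_a[OF T_scaled_le]) auto
  moreover have "\<forall>\<^sub>F n in sequentially. 29/10 * T (a n) \<le> T (1/3 * a n)"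
    by (rule at_a[OF T_scaled_ge]) auto
  moreover have "\<forall>\<^sub>F n in sequentially. tail_mean (a n) - tail_mean (2 * a n) \<le> e * tail_mean (a n)"
    by (rule at_a[OF tail_mean_slowly_varying]) (use e in auto)
  moreover have "\<forall>\<^sub>F n in sequentially. tail_mean (1/3 * a n) - tail_mean (3 * (1/3 * a n)) \<le> e * tail_mean (1/3 * a n)"
  proof (rule eventually_compose_filterlim[OF tail_mean_slowly_varying])
    show "filterlim (\<lambda>n. 1/3 * a n) at_top sequentially"
      by (rule filterlim_tendsto_pos_mult_at_top[OF tendsto_const _ a_top]) simp
  qed (use e in auto)
  moreover have "\<forall>\<^sub>F n in sequentially. 0 < a n" by (intro at_a eventually_gt_at_top)
  moreover have "\<forall>\<^sub>F n in sequentially. 2 * N + 1 \<le> n" by (rule eventually_ge_at_top)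
  ultimately show ?thesis
  proof eventually_elim
    case (elim n)
    show ?case
    proof (intro allI impI)
      fix k assume k: "k \<le> n" "n \<le> 2 * k"
      have kN: "N \<le> k" "N \<le> n" "0 < k" "0 < n" using elim k by linarith+
      note bk = N[OF kN(1)] and bn = N[OF kN(2)]
      have Tk: "0 < T (a k)" "0 < T (a n)" by (rule T_pos)+
      have "real n * T (a k) \<le> (2 * real k) * T (a k)" using k Tk by (intro mult_right_mono) auto
      also have "\<dots> < 29/10 * (real n * T (a n))" using bk bn by linarith
      finally have "real n * T (a k) < real n * (29/10 * T (a n))" by simp
      then have "T (a k) < 29/10 * T (a n)" using kN by simp
      then have "T (a k) < T (1/3 * a n)" using elim by linarith
      then have lo: "1/3 * a n < a k" using T_antimono[of "a k" "1/3 * a n"] by (meson not_le)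
      have "real k * T (a k) \<le> real n * T (a k)" using k Tk by (intro mult_right_mono) auto
      then have "6/10 * (real n * T (a n)) < real n * T (a k)" using bk bn by linarith
      then have "real n * (6/10 * T (a n)) < real n * T (a k)" by simp
      then have "6/10 * T (a n) < T (a k)" using kN by simp
      then have "T (2 * a n) < T (a k)" using elim by linarith
      then have hi: "a k < 2 * a n" using T_antimono[of "2 * a n" "a k"] by (meson not_le)
      have "tail_mean (2 * a n) \<le> tail_mean (a k)" using lo hi elim by (intro tail_mean_antimono) auto
      then have 1: "(1 - e) * tail_mean (a n) \<le> tail_mean (a k)" using elim(3) by (simp add: algebra_simps)
      have l0: "0 < tail_mean (a n)" "0 < tail_mean (1/3 * a n)" using elim tail_mean_pos by auto
      have "tail_mean (a k) \<le> tail_mean (1/3 * a n)" using lo elim by (intro tail_mean_antimono) auto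
      also have "\<dots> \<le> (1 + 2 * e) * tail_mean (a n)"
      proof -
        have "(1 - e) * tail_mean (1/3 * a n) \<le> tail_mean (a n)" using elim(4) by (simp add: algebra_simps)
        then have "(1 + 2 * e) * ((1 - e) * tail_mean (1/3 * a n)) \<le> (1 + 2 * e) * tail_mean (a n)"
          using e by (intro mult_left_mono) auto
        moreover have "1 \<le> (1 + 2 * e) * (1 - e)"
        proof -
          have "e * (2 * e) \<le> e * 1" using e by (intro mult_left_mono) auto
          then show ?thesis by (simp add: algebra_simps)
        qed
        then have "1 * tail_mean (1/3 * a n) \<le> ((1 + 2 * e) * (1 - e)) * tail_mean (1/3 * a n)"
          using l0 by (intro mult_right_mono) auto
        ultimately show ?thesis by (simp add: mult.assoc)
      qed
      finally show "(1 - e) * tail_mean (a n) \<le> tail_mean (a k) \<and> tail_mean (a k) \<le> (1 + 2 * e) * tail_mean (a n)" using 1 by simp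
    qed
  qed
qed

text \<open>
  The ratio \<open>s\<close> of \<open>drift k\<close> and \<open>drift n\<close> is about \<open>k / n\<close>. Regular variation of \<open>T\<close> divides
  the tail by about \<open>s\<close>, which cancels the factor \<open>k / n\<close>.
\<close>

lemma big_jump_slowly_varying:
  assumes e: "0 < e"
  shows "\<forall>\<^sub>F n in sequentially. \<forall>k\<le>n. n \<le> 2 * k \<longrightarrow> \<bar>big_jump k - big_jump n\<bar> \<le> e * big_jump n"
proof -
  define d where "d = min (e / 8) (1 / 8)"
  have d: "0 < d" "d \<le> 1/8" "8 * d \<le> e" using e unfolding d_def by auto
  have "\<forall>\<^sub>F n in sequentially. \<forall>s. 1/4 \<le> s \<and> s \<le> 2 \<longrightarrow> \<bar>s * T (s * drift n) / T (drift n) - 1\<bar> \<le> d"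
    by (rule at_drift[OF T_uniform]) (use d in auto)
  moreover have "\<forall>\<^sub>F n in sequentially. \<forall>k\<le>n. n \<le> 2 * k \<longrightarrow>
    (1 - d) * tail_mean (a n) \<le> tail_mean (a k) \<and> tail_mean (a k) \<le> (1 + 2 * d) * tail_mean (a n)"
    by (rule tail_mean_a_comparable) (use d in auto)
  moreover have "\<forall>\<^sub>F n in sequentially. 0 < a n" by (intro at_a eventually_gt_at_top)
  moreover have "\<forall>\<^sub>F n :: nat in sequentially. 0 < n" by (rule eventually_gt_at_top)
  ultimately show ?thesis
  proof eventually_elim
    case (elim n)
    show ?case
    proof (intro allI impI)
      fix k assume k: "k \<le> n" "n \<le> 2 * k"
      have l: "0 < tail_mean (a n)" using elim tail_mean_pos by simp
      define r where "r = tail_mean (a k) / tail_mean (a n)"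
      define s where "s = real k / real n * r"
      have r: "1 - d \<le> r" "r \<le> 1 + 2 * d"
        unfolding r_def using elim(2) k l by (auto simp: pos_le_divide_eq pos_divide_le_eq)
      have kn: "1/2 \<le> real k / real n" "real k / real n \<le> 1"
        using k elim by (auto simp: field_simps)
      have "1/2 * (1/2) \<le> real k / real n * r" using kn r d by (intro mult_mono) auto
      moreover have "real k / real n * r \<le> 1 * 2" using kn r d by (intro mult_mono) auto
      ultimately have s: "1/4 \<le> s" "s \<le> 2" unfolding s_def by auto
      have Bk: "drift k = s * drift n" unfolding s_def r_def drift_def using l elim by simp
      define q where "q = s * T (s * drift n) / T (drift n)"
      have q: "\<bar>q - 1\<bar> \<le> d" unfolding q_def using elim(1) s by blast
      have Tn: "0 < T (drift n)" by (rule T_pos)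
      have bj: "0 < big_jump n" using elim by (intro big_jump_pos)
      have r0: "0 < r" using r d by linarith
      have "r * big_jump k = q * big_jump n"
        unfolding big_jump_def Bk q_def s_def using Tn elim by (simp add: field_simps)
      then have eq: "r * (big_jump k - big_jump n) = (q - r) * big_jump n" by (simp add: algebra_simps)
      have "\<bar>q - r\<bar> \<le> 3 * d" using q r by linarith
      then have "\<bar>(q - r) * big_jump n\<bar> \<le> 3 * d * big_jump n"
        unfolding abs_mult using bj by (simp add: mult_right_mono)
      then have *: "r * \<bar>big_jump k - big_jump n\<bar> \<le> 3 * d * big_jump n"
        unfolding eq[symmetric] abs_mult using r0 by simp
      have "1/2 * \<bar>big_jump k - big_jump n\<bar> \<le> r * \<bar>big_jump k - big_jump n\<bar>"
        using r d by (intro mult_right_mono) auto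
      also note *
      finally have "\<bar>big_jump k - big_jump n\<bar> \<le> 6 * d * big_jump n" by simp
      also have "\<dots> \<le> e * big_jump n" using d bj by (intro mult_right_mono) auto
      finally show "\<bar>big_jump k - big_jump n\<bar> \<le> e * big_jump n" .
    qed
  qed
qed

text \<open>
  The level \<open>z\<close> of the large step is slightly below the drift and the truncation level is
  \<open>d * drift n\<close> with \<open>d\<close> much smaller than \<open>h\<^sup>2\<close>, so that Chebyshev's bound, of order
  \<open>d / h\<^sup>2 * big_jump n\<close>, is small.
\<close>

lemma end_nonneg_le_big_jump:
  assumes e: "0 < e" "e \<le> 1"
  shows "\<forall>\<^sub>F n in sequentially. end_nonneg n \<le> (1 + e) * big_jump n"
proof -
  obtain K where K: "K > 0" and cut_moment: "\<forall>\<^sub>F y in at_top. cut_moment y \<le> K * (y\<^sup>2 * T y)" using cut_moment_le by blast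
  define h where "h = e / 8"
  have h: "0 < h" "h < 1" "1 / (1 - h) < 1 + e / 3"
  proof -
    show h0: "0 < h" "h < 1" using e unfolding h_def by auto
    have "e * e \<le> e * 1" using e by (intro mult_left_mono) auto
    then have "1 < (1 + e / 3) * (1 - h)" using e unfolding h_def by (simp add: algebra_simps)
    then show "1 / (1 - h) < 1 + e / 3" using h0 by (simp add: pos_divide_less_eq)
  qed
  \<comment> \<open>makes the Chebyshev term \<open>8 * K * d / h\<^sup>2 * big_jump n\<close> at most \<open>e / 3 * big_jump n\<close>\<close>
  define d where "d = min 1 (e * h\<^sup>2 / (24 * K))"
  have d: "0 < d" "d \<le> 1" "24 * K * d \<le> e * h\<^sup>2"
    using e h K unfolding d_def by (auto simp: field_simps min_def)
  have dB_top: "filterlim (\<lambda>n. d * drift n) at_top sequentially"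
    by (rule filterlim_tendsto_pos_mult_at_top[OF tendsto_const d(1) drift_top])
  have "\<forall>\<^sub>F n in sequentially. T ((1 - h) * drift n) \<le> (1 + e / 3) * T (drift n)"
    by (rule at_drift[OF T_scaled_le]) (use h in auto)
  moreover have "\<forall>\<^sub>F n in sequentially. T (d * drift n) \<le> 2 / d * T (drift n)"
    by (rule at_drift[OF T_scaled_le]) (use d in \<open>auto simp: divide_strict_right_mono\<close>)
  moreover have "\<forall>\<^sub>F n in sequentially. cut_moment (d * drift n) \<le> K * ((d * drift n)\<^sup>2 * T (d * drift n))"
    by (rule eventually_compose_filterlim[OF cut_moment dB_top])
  moreover have "\<forall>\<^sub>F n in sequentially. (1 - h / 2) * drift n \<le> real n * tail_mean (drift n)"
    by (rule tail_mean_drift) (use h in auto)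
  moreover have "\<forall>\<^sub>F n in sequentially. big_jump n \<le> e / 3 * (d / 2)\<^sup>2"
    by (rule big_jump_small) (use e d in auto)
  moreover have "\<forall>\<^sub>F n in sequentially. 0 < drift n" by (intro at_drift eventually_gt_at_top)
  moreover have "\<forall>\<^sub>F n :: nat in sequentially. 0 < n" by (rule eventually_gt_at_top)
  ultimately show ?thesis
  proof eventually_elim
    case (elim n)
    define y where "y = d * drift n"
    define z where "z = (1 - h) * drift n"
    define t where "t = h / 2 * drift n"
    have bj: "0 < big_jump n" using elim by (intro big_jump_pos)
    have yB: "0 \<le> y" "y \<le> drift n" unfolding y_def using d elim by (auto simp: mult_left_le_one_le)
    have "real n * tail_mean (drift n) \<le> real n * tail_mean y"
      using yB by (intro mult_left_mono tail_mean_antimono) auto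
    then have "t \<le> real n * tail_mean y - z"
      using elim(4) unfolding t_def z_def by (simp add: algebra_simps)
    then have total: "end_nonneg n \<le> real n * T z + (real n * T y)\<^sup>2 + real n * cut_moment y / t\<^sup>2"
      using elim d h by (intro end_nonneg_upper) (auto simp: y_def z_def t_def)
    have one: "real n * T z \<le> (1 + e / 3) * big_jump n"
      using mult_left_mono[OF elim(1), of "real n"] by (simp add: z_def big_jump_def mult_ac)
    have Ty: "real n * T y \<le> 2 / d * big_jump n"
      using mult_left_mono[OF elim(2), of "real n"] by (simp add: y_def big_jump_def mult_ac)
    have "(real n * T y)\<^sup>2 \<le> (2 / d * big_jump n)\<^sup>2"
      using Ty T_pos[of y] by (intro power_mono) (auto simp: less_imp_le)
    also have "\<dots> = (2 / d)\<^sup>2 * big_jump n * big_jump n" by (simp add: power2_eq_square)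
    also have "\<dots> \<le> (2 / d)\<^sup>2 * (e / 3 * (d / 2)\<^sup>2) * big_jump n"
      using elim bj by (intro mult_right_mono mult_left_mono) auto
    also have "\<dots> = e / 3 * big_jump n" using d by (simp add: power2_eq_square)
    finally have two: "(real n * T y)\<^sup>2 \<le> e / 3 * big_jump n" .
    have "real n * cut_moment y / t\<^sup>2 \<le> real n * (K * (y\<^sup>2 * T y)) / t\<^sup>2"
      using elim(3) unfolding y_def by (intro divide_right_mono mult_left_mono) auto
    also have "\<dots> = 4 * K * d\<^sup>2 / h\<^sup>2 * (real n * T y)"
      using elim h by (simp add: y_def t_def power2_eq_square field_simps)
    also have "\<dots> \<le> 4 * K * d\<^sup>2 / h\<^sup>2 * (2 / d * big_jump n)"
      using Ty K by (intro mult_left_mono) auto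
    also have "\<dots> = (8 * K * d / h\<^sup>2) * big_jump n"
      using d by (simp add: power2_eq_square)
    also have "\<dots> \<le> e / 3 * big_jump n"
    proof -
      have "8 * K * d / h\<^sup>2 \<le> e / 3" using d(3) h by (simp add: pos_divide_le_eq)
      then show ?thesis using bj by (intro mult_right_mono) auto
    qed
    finally have three: "real n * cut_moment y / t\<^sup>2 \<le> e / 3 * big_jump n" .
    have "(1 + e / 3) * big_jump n + e / 3 * big_jump n + e / 3 * big_jump n = (1 + e) * big_jump n"
      by (simp add: algebra_simps)
    then show ?case using total one two three by linarith
  qed
qed

text \<open>
  Here the large step is slightly above the drift and truncation takes place at the drift itself:
  Chebyshev's bound only has to tend to 0, as it multiplies the probability of a large step.
\<close>

lemma end_nonneg_ge_big_jump:
  assumes e: "0 < e" "e \<le> 1"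
  shows "\<forall>\<^sub>F n in sequentially. (1 - e) * big_jump n \<le> end_nonneg n"
proof -
  obtain K where K: "K > 0" and cut_moment: "\<forall>\<^sub>F y in at_top. cut_moment y \<le> K * (y\<^sup>2 * T y)" using cut_moment_le by blast
  define h where "h = e / 4"
  have h: "0 < h" "1 - e / 3 < 1 / (1 + h)"
  proof -
    show h0: "0 < h" using e unfolding h_def by auto
    have "(1 - e / 3) * (1 + h) = 1 - (e / 12 + e * e / 12)" unfolding h_def by (simp add: algebra_simps)
    moreover have "0 < e / 12 + e * e / 12" using e by (intro add_pos_pos) auto
    ultimately have "(1 - e / 3) * (1 + h) < 1" by linarith
    then show "1 - e / 3 < 1 / (1 + h)" using h0 by (simp add: pos_less_divide_eq)
  qed
  have "\<forall>\<^sub>F n in sequentially. (1 - e / 3) * T (drift n) \<le> T ((1 + h) * drift n)"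
    by (rule at_drift[OF T_scaled_ge]) (use h in auto)
  moreover have "\<forall>\<^sub>F n in sequentially. cut_moment (drift n) \<le> K * ((drift n)\<^sup>2 * T (drift n))" by (rule at_drift[OF cut_moment])
  moreover have "\<forall>\<^sub>F n in sequentially. big_jump n \<le> e / 3" by (rule big_jump_small) (use e in auto)
  moreover have "\<forall>\<^sub>F n in sequentially. big_jump n \<le> e / 3 * (h\<^sup>2 / K)"
    by (rule big_jump_small) (use e h K in auto)
  moreover have "\<forall>\<^sub>F n in sequentially. 0 < drift n" by (intro at_drift eventually_gt_at_top)
  moreover have "\<forall>\<^sub>F n in sequentially. 0 < a n" by (intro at_a eventually_gt_at_top)
  moreover have "\<forall>\<^sub>F n in sequentially. 1 * a n \<le> drift n" by (rule drift_large) auto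
  moreover have "\<forall>\<^sub>F n :: nat in sequentially. 0 < n" by (rule eventually_gt_at_top)
  ultimately show ?thesis
  proof eventually_elim
    case (elim n)
    define y where "y = drift n"
    define z where "z = (1 + h) * drift n"
    define t where "t = h * drift n"
    define w where "w = real n * T z"
    define q where "q = real n * cut_moment y / t\<^sup>2"
    have bj: "0 < big_jump n" using elim by (intro big_jump_pos)
    have "real n * tail_mean (drift n) \<le> real n * tail_mean (a n)"
      using elim by (intro mult_left_mono tail_mean_antimono) auto
    then have "real n * tail_mean y \<le> drift n" by (simp add: y_def drift_def)
    then have "w / (1 + w) - w * q \<le> end_nonneg n"
      unfolding w_def q_def using elim h
      by (intro end_nonneg_lower) (auto simp: y_def z_def t_def algebra_simps)
    have w: "0 < w" "(1 - e / 3) * big_jump n \<le> w" "w \<le> big_jump n"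
    proof -
      show "0 < w" unfolding w_def using elim T_pos by simp
      show "(1 - e / 3) * big_jump n \<le> w"
        using mult_left_mono[OF elim(1), of "real n"] by (simp add: w_def z_def big_jump_def mult_ac)
      have "drift n \<le> z" unfolding z_def using h elim by (simp add: algebra_simps)
      then show "w \<le> big_jump n" unfolding w_def big_jump_def by (intro mult_left_mono T_antimono) auto
    qed
    have "q \<le> real n * (K * (y\<^sup>2 * T y)) / t\<^sup>2"
      unfolding q_def y_def using elim by (intro divide_right_mono mult_left_mono) auto
    also have "\<dots> = K / h\<^sup>2 * big_jump n"
      using elim h by (simp add: y_def t_def big_jump_def power2_eq_square field_simps)
    also have "\<dots> \<le> K / h\<^sup>2 * (e / 3 * (h\<^sup>2 / K))" using elim K by (intro mult_left_mono) auto
    also have "\<dots> = e / 3" using K h by simp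
    finally have q: "q \<le> e / 3" .
    have "1 - e / 3 \<le> 1 / (1 + w)"
    proof -
      have "(1 - e / 3) * (1 + w) \<le> (1 - e / 3) * (1 + e / 3)"
        using w elim(3) e by (intro mult_left_mono) auto
      also have "\<dots> \<le> 1" by (simp add: algebra_simps)
      finally show ?thesis using w by (simp add: pos_le_divide_eq)
    qed
    then have "1 - 2 * e / 3 \<le> 1 / (1 + w) - q" using q by simp
    have "(1 - e) * big_jump n \<le> ((1 - e / 3) * (1 - 2 * e / 3)) * big_jump n"
      using bj e by (intro mult_right_mono) (auto simp: algebra_simps)
    also have "\<dots> = (1 - 2 * e / 3) * ((1 - e / 3) * big_jump n)" by simp
    also have "\<dots> \<le> (1 - 2 * e / 3) * w" using w e by (intro mult_left_mono) auto
    also have "\<dots> \<le> (1 / (1 + w) - q) * w"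
      using w \<open>1 - 2 * e / 3 \<le> 1 / (1 + w) - q\<close> by (intro mult_right_mono) auto
    also have "\<dots> = w / (1 + w) - w * q" by (simp add: algebra_simps)
    also have "\<dots> \<le> end_nonneg n" by fact
    finally show ?case .
  qed
qed

lemma end_nonneg_big_jump_close:
  assumes e: "0 < e"
  shows "\<forall>\<^sub>F n in sequentially. \<bar>end_nonneg n - big_jump n\<bar> \<le> e * big_jump n"
proof -
  define d where "d = min e 1"
  have d: "0 < d" "d \<le> 1" "d \<le> e" using e unfolding d_def by auto
  have "\<forall>\<^sub>F n :: nat in sequentially. 0 < n" by (rule eventually_gt_at_top)
  with end_nonneg_le_big_jump[OF d(1,2)] end_nonneg_ge_big_jump[OF d(1,2)] show ?thesis
  proof eventually_elim
    case (elim n)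
    have "d * big_jump n \<le> e * big_jump n" using d big_jump_pos[OF elim(3)] by (intro mult_right_mono) auto
    then show ?case using elim by (auto simp: abs_le_iff algebra_simps)
  qed
qed

lemma end_nonneg_asymp: "(\<lambda>n. end_nonneg n / big_jump n) \<longlonglongrightarrow> 1"
proof (rule tendstoI)
  fix e :: real assume e: "0 < e"
  then have "0 < e / 2" by simp
  from end_nonneg_big_jump_close[OF this] eventually_gt_at_top[of 0]
  show "\<forall>\<^sub>F n in sequentially. dist (end_nonneg n / big_jump n) 1 < e"
  proof eventually_elim
    case (elim n)
    have bj: "0 < big_jump n" using elim by (intro big_jump_pos)
    have "dist (end_nonneg n / big_jump n) 1 = \<bar>end_nonneg n - big_jump n\<bar> / big_jump n"
    proof -
      have "end_nonneg n / big_jump n - 1 = (end_nonneg n - big_jump n) / big_jump n"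
        using bj by (simp add: field_simps)
      then show ?thesis using bj by (simp add: dist_real_def)
    qed
    also have "\<dots> \<le> e / 2" using elim bj by (simp add: pos_divide_le_eq)
    finally show ?case using e by simp
  qed
qed

lemma end_nonneg_null: "end_nonneg \<longlonglongrightarrow> 0"
proof -
  have "big_jump \<longlonglongrightarrow> 0"
  proof (rule tendstoI)
    fix e :: real assume "0 < e"
    then show "\<forall>\<^sub>F n in sequentially. dist (big_jump n) 0 < e"
      using big_jump_small[of "e / 2"] T_pos
      by (auto elim!: eventually_mono simp: big_jump_def abs_mult less_imp_le)
  qed
  from tendsto_mult[OF end_nonneg_asymp this]
  have "(\<lambda>n. end_nonneg n / big_jump n * big_jump n) \<longlonglongrightarrow> 0" by simp
  then show ?thesis
    by (rule Lim_transform_eventually)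
      (use big_jump_pos in \<open>auto intro!: eventually_mono[OF eventually_gt_at_top[of 0]] simp: less_imp_neq[symmetric]\<close>)
qed

lemma end_nonneg_slowly_varying:
  assumes e: "0 < e"
  shows "\<forall>\<^sub>F n in sequentially. 0 < end_nonneg n \<and>
    (\<forall>k\<le>n. n \<le> 2 * k \<longrightarrow> \<bar>end_nonneg k - end_nonneg n\<bar> \<le> e * end_nonneg n)"
proof -
  define d where "d = min (e / 8) (1 / 2)"
  have d: "0 < d" "d \<le> 1/2" "8 * d \<le> e" using e unfolding d_def by auto
  obtain N where N: "\<And>n. N \<le> n \<Longrightarrow> \<bar>end_nonneg n - big_jump n\<bar> \<le> d * big_jump n"
    using end_nonneg_big_jump_close[OF d(1)] unfolding eventually_sequentially by auto
  have "\<forall>\<^sub>F n in sequentially. 2 * N + 1 \<le> n" by (rule eventually_ge_at_top)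
  with big_jump_slowly_varying[OF d(1)] show ?thesis
  proof eventually_elim
    case (elim n)
    have bj: "0 < big_jump n" using elim by (intro big_jump_pos) auto
    have n: "\<bar>end_nonneg n - big_jump n\<bar> \<le> d * big_jump n" using N[of n] elim by simp
    have "d * big_jump n \<le> 1/2 * big_jump n" using d bj by (intro mult_right_mono) auto
    then have half: "1/2 * big_jump n \<le> end_nonneg n" using n by linarith
    show ?case
    proof (intro conjI allI impI)
      show "0 < end_nonneg n" using half bj by linarith
      fix k assume k: "k \<le> n" "n \<le> 2 * k"
      have kN: "\<bar>end_nonneg k - big_jump k\<bar> \<le> d * big_jump k" using N[of k] elim k by simp
      have kn: "\<bar>big_jump k - big_jump n\<bar> \<le> d * big_jump n" using elim(1) k by blast
      have "d * big_jump n \<le> 1 * big_jump n" using d bj by (intro mult_right_mono) auto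
      then have "big_jump k \<le> 2 * big_jump n" using kn by linarith
      then have "d * big_jump k \<le> d * (2 * big_jump n)" using d by (intro mult_left_mono) auto
      then have "\<bar>end_nonneg k - end_nonneg n\<bar> \<le> 4 * d * big_jump n" using kN kn n by linarith
      also have "\<dots> = 8 * d * (1/2 * big_jump n)" by simp
      also have "\<dots> \<le> 8 * d * end_nonneg n" using half d by (intro mult_left_mono) auto
      also have "\<dots> \<le> e * end_nonneg n" using d half bj by (intro mult_right_mono) auto
      finally show "\<bar>end_nonneg k - end_nonneg n\<bar> \<le> e * end_nonneg n" .
    qed
  qed
qed

lemma stay_nonneg_positive: "0 < stay_nonneg n"
proof (rule stay_nonneg_pos)
  show "0 < measure_pmf.prob \<mu> {0..}"
    using T_pos[of 0] unfolding T_def by (simp add: atLeast_def)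
qed

lemma stay_neg_nonneg: "0 \<le> stay_neg n"
  by (simp add: stay_neg_def)

sublocale spitzer_sequences stay_nonneg end_nonneg
  using stay_nonneg_positive stay_nonneg_antimono end_nonneg_null spitzer_identity
  by unfold_locales (auto simp: end_nonneg_def)

lemma stay_neg_asymp: "(\<lambda>n. stay_neg n * U n) \<longlonglongrightarrow> 1"
  using stay_neg_nonneg stay_neg_antimono stay_duality by (rule dual_asymp)

lemma stay_nonneg_asymp: "(\<lambda>n. stay_nonneg n / (T (drift n) * U n)) \<longlonglongrightarrow> 1"
proof -
  have "(\<lambda>n. real n * stay_nonneg n / (end_nonneg n * U n)) \<longlonglongrightarrow> 1"
    using end_nonneg_slowly_varying by (rule u_asymp)
  from tendsto_mult[OF this end_nonneg_asymp]
  have "(\<lambda>n. real n * stay_nonneg n / (end_nonneg n * U n) * (end_nonneg n / big_jump n)) \<longlonglongrightarrow> 1" by simp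
  moreover have "\<forall>\<^sub>F n in sequentially. real n * stay_nonneg n / (end_nonneg n * U n) * (end_nonneg n / big_jump n) =
      stay_nonneg n / (T (drift n) * U n)"
    using end_nonneg_slowly_varying[of 1, simplified] eventually_gt_at_top[of 0]
    by eventually_elim (auto simp: big_jump_def)
  ultimately show ?thesis by (rule Lim_transform_eventually)
qed

end

section \<open>From the walk on the probability space to lists\<close>

lemma countable_distr_pmf:
  fixes Z :: "'a \<Rightarrow> 'b :: countable"
  assumes "prob_space M" "Z \<in> measurable M (count_space UNIV)"
  shows "\<exists>\<nu>. measure_pmf \<nu> = distr M (count_space UNIV) Z"
proof -
  let ?D = "distr M (count_space UNIV) Z"
  interpret D: prob_space ?D by (rule prob_space.prob_space_distr[OF assms])
  have "AE x in ?D. measure ?D {x} \<noteq> 0"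
    by (subst D.AE_support_countable) (auto intro!: exI[of _ UNIV])
  then have "measure_pmf (Abs_pmf ?D) = ?D"
    by (intro Abs_pmf_inverse) (auto intro: D.prob_space_axioms)
  then show ?thesis by blast
qed

lemma measurable_map_list:
  fixes Y :: "'i \<Rightarrow> 'a \<Rightarrow> 'b :: countable"
  assumes "\<And>i. i \<in> set is \<Longrightarrow> Y i \<in> measurable M (count_space UNIV)"
  shows "(\<lambda>\<omega>. map (\<lambda>i. Y i \<omega>) is) \<in> measurable M (count_space UNIV)"
  using assms
proof (induction "is")
  case (Cons i "is")
  then have [measurable]: "Y i \<in> measurable M (count_space UNIV)"
    "(\<lambda>\<omega>. map (\<lambda>i. Y i \<omega>) is) \<in> measurable M (count_space UNIV)" by auto
  show ?case by simp
qed simp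

lemma iid_prefix_distr:
  fixes Y :: "nat \<Rightarrow> 'a \<Rightarrow> 'b :: countable"
  assumes M: "prob_space M"
    and indep: "prob_space.indep_vars M (\<lambda>_. count_space UNIV) Y {1..}"
    and distr: "\<And>i. 1 \<le> i \<Longrightarrow> distr M (count_space UNIV) (Y i) = measure_pmf \<nu>"
  shows "distr M (count_space UNIV) (\<lambda>\<omega>. map (\<lambda>i. Y i \<omega>) [1..<Suc n]) = measure_pmf (replicate_pmf n \<nu>)"
proof -
  interpret prob_space M by fact
  let ?Z = "\<lambda>\<omega>. map (\<lambda>i. Y i \<omega>) [1..<Suc n]"
  have Y: "Y i \<in> measurable M (count_space UNIV)" if "1 \<le> i" for i
    using indep that unfolding indep_vars_def2 by auto
  have Z: "?Z \<in> measurable M (count_space UNIV)" by (rule measurable_map_list) (auto intro: Y)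
  obtain \<rho> where \<rho>: "measure_pmf \<rho> = distr M (count_space UNIV) ?Z"
    using countable_distr_pmf[OF M Z] by blast
  have single: "prob (Y i -` {x} \<inter> space M) = pmf \<nu> x" if "1 \<le> i" for i x
    using measure_distr[OF Y[OF that], of "{x}"] by (simp add: distr[OF that] pmf.rep_eq)
  have "\<rho> = replicate_pmf n \<nu>"
  proof (rule pmf_eqI)
    fix xs
    have "pmf \<rho> xs = prob (?Z -` {xs} \<inter> space M)"
      unfolding pmf.rep_eq \<rho> by (rule measure_distr[OF Z]) simp
    also have "\<dots> = pmf (replicate_pmf n \<nu>) xs"
    proof (cases "length xs = n")
      case False
      then have "?Z -` {xs} \<inter> space M = {}" by auto
      then show ?thesis using False by (simp add: pmf_replicate)
    next
      case True
      show ?thesis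
      proof (cases "n = 0")
        case True
        then show ?thesis using \<open>length xs = n\<close> by (simp add: pmf_replicate prob_space)
      next
        case False
        have "?Z -` {xs} \<inter> space M = (\<Inter>i\<in>{1..n}. Y i -` {xs ! (i - 1)} \<inter> space M)"
        proof -
          have "?Z \<omega> = xs \<longleftrightarrow> (\<forall>i\<in>{1..n}. Y i \<omega> = xs ! (i - 1))" for \<omega>
          proof
            assume *: "?Z \<omega> = xs"
            show "\<forall>i\<in>{1..n}. Y i \<omega> = xs ! (i - 1)"
              unfolding *[symmetric] by (auto simp del: upt_Suc)
          next
            assume *: "\<forall>i\<in>{1..n}. Y i \<omega> = xs ! (i - 1)"
            show "?Z \<omega> = xs"
              by (rule nth_equalityI) (use * True in \<open>auto simp del: upt_Suc\<close>)
          qed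
          then show ?thesis using False by auto
        qed
        also have "prob \<dots> = (\<Prod>i\<in>{1..n}. prob (Y i -` {xs ! (i - 1)} \<inter> space M))"
          by (rule indep_varsD[OF indep]) (use False in auto)
        also have "\<dots> = (\<Prod>i\<in>{1..n}. pmf \<nu> (xs ! (i - 1)))"
          by (intro prod.cong refl single) auto
        also have "\<dots> = (\<Prod>i\<in>{0..<n}. pmf \<nu> (xs ! i))"
          by (rule prod.reindex_bij_witness[of _ Suc "\<lambda>i. i - 1"]) auto
        also have "\<dots> = pmf (replicate_pmf n \<nu>) xs"
          using True by (simp add: pmf_replicate prod.list_conv_set_nth)
        finally show ?thesis .
      qed
    qed
    finally show "pmf \<rho> xs = pmf (replicate_pmf n \<nu>) xs" .
  qed
  with \<rho> show ?thesis by simp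
qed

lemma less_INF_enat: "enat n < (INF i\<in>S. enat i) \<longleftrightarrow> (\<forall>i\<in>S. n < i)"
proof -
  have "enat n < (INF i\<in>S. enat i) \<longleftrightarrow> enat (Suc n) \<le> (INF i\<in>S. enat i)"
    by (simp add: Suc_ile_eq)
  also have "\<dots> \<longleftrightarrow> (\<forall>i\<in>S. n < i)" by (simp add: le_INF_iff Suc_le_eq)
  finally show ?thesis .
qed

lemma less_first_negative_time:
  "W 0 \<omega> = 0 \<Longrightarrow> enat n < first_negative_time W \<omega> \<longleftrightarrow> (\<forall>i\<le>n. 0 \<le> W i \<omega>)"
proof -
  assume W0: "W 0 \<omega> = 0"
  have "enat n < first_negative_time W \<omega> \<longleftrightarrow> (\<forall>i. 1 \<le> i \<and> W i \<omega> < 0 \<longrightarrow> n < i)"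
    unfolding first_negative_time_def less_INF_enat by auto
  also have "\<dots> \<longleftrightarrow> (\<forall>i\<le>n. 0 \<le> W i \<omega>)"
    using W0 by (metis less_one linorder_not_less order_refl)
  finally show ?thesis .
qed

lemma less_first_nonneg_time:
  "enat n < first_nonneg_time W \<omega> \<longleftrightarrow> (\<forall>i\<in>{1..n}. W i \<omega> < 0)"
proof -
  have "enat n < first_nonneg_time W \<omega> \<longleftrightarrow> (\<forall>i. 0 < i \<and> 0 \<le> W i \<omega> \<longrightarrow> n < i)"
    unfolding first_nonneg_time_def less_INF_enat by auto
  also have "\<dots> \<longleftrightarrow> (\<forall>i\<in>{1..n}. W i \<omega> < 0)"
    unfolding Ball_def atLeastAtMost_iff by (intro iff_allI) auto
  finally show ?thesis .
qed

lemma psum_map_walk: "i \<le> n \<Longrightarrow> psum (map (\<lambda>i. Y i \<omega>) [1..<Suc n]) i = walk Y i \<omega>"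
proof -
  assume "i \<le> n"
  then have "take i (map (\<lambda>i. Y i \<omega>) [1..<Suc n]) = map (\<lambda>i. Y i \<omega>) [1..<Suc i]"
    by (simp add: take_map take_upt del: upt_Suc)
  then have "psum (map (\<lambda>i. Y i \<omega>) [1..<Suc n]) i = (\<Sum>j\<leftarrow>[1..<Suc i]. Y j \<omega>)"
    by (simp add: psum_def del: upt_Suc)
  also have "\<dots> = walk Y i \<omega>"
    by (simp add: walk_def interv_sum_list_conv_sum_set_nat atLeastLessThanSuc_atLeastAtMost del: upt_Suc)
  finally show ?thesis .
qed

theorem proposition12:
  fixes M :: "'a measure"
    and X :: "'a \<Rightarrow> int"
    and Y :: "nat \<Rightarrow> 'a \<Rightarrow> int"
    and L :: "real \<Rightarrow> real"
    and a b :: "nat \<Rightarrow> real"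
    and W :: "nat \<Rightarrow> 'a \<Rightarrow> int"
    and \<zeta> T\<^sub>1 :: "'a \<Rightarrow> enat"
  defines "W \<equiv> walk Y"
    and "\<zeta> \<equiv> first_negative_time W"
    and "T\<^sub>1 \<equiv> first_nonneg_time W"
  assumes "prob_space M"
    and X_rv: "X \<in> measurable M (count_space UNIV)"
    and X_integrable: "integrable M (\<lambda>\<omega>. real_of_int (X \<omega>))"
    and X_centered: "(\<integral>\<omega>. real_of_int (X \<omega>) \<partial>M) = 0"
    and X_ge: "measure M {\<omega> \<in> space M. X \<omega> < -1} = 0"
    and L_slowly_varying: "slowly_varying L"
    and X_tail: "(\<lambda>x::real. measure M {\<omega> \<in> space M. x \<le> real_of_int (X \<omega>)})
                   \<sim>[at_top] (\<lambda>x. L x / x)"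
    and Y_indep: "prob_space.indep_vars M (\<lambda>_. count_space UNIV) Y {1..}"
    and Y_distr: "\<And>i. i \<ge> 1 \<Longrightarrow> distr M (count_space UNIV) (Y i) = distr M (count_space UNIV) X"
    and a: "(\<lambda>n. real n * measure M {\<omega> \<in> space M. a n \<le> real_of_int (X \<omega>)}) \<longlonglongrightarrow> 1"
    and b: "\<And>n. n \<ge> 1 \<Longrightarrow>
              b n = real n * (\<integral>\<omega>. real_of_int (X \<omega>) *
                      indicator {\<omega>. \<bar>real_of_int (X \<omega>)\<bar> \<le> a n} \<omega> \<partial>M)"
  shows "\<exists>\<Lambda>::real \<Rightarrow> real. strict_mono_on {0..} \<Lambda> \<and> slowly_varying \<Lambda> \<and>
           (\<lambda>n::nat. measure M {\<omega> \<in> space M. enat n < \<zeta> \<omega>})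
             \<sim>[sequentially] (\<lambda>n. L \<bar>b n\<bar> / \<bar>b n\<bar> * \<Lambda> (real n)) \<and>
           (\<lambda>n::nat. measure M {\<omega> \<in> space M. enat n < T\<^sub>1 \<omega>})
             \<sim>[sequentially] (\<lambda>n. 1 / \<Lambda> (real n)) \<and>
           (\<lambda>n::nat. \<Sum>k=0..n. measure M {\<omega> \<in> space M. enat k < \<zeta> \<omega>})
             \<sim>[sequentially] (\<lambda>n. \<Lambda> (real n))"
proof -
  interpret M: prob_space M by fact
  obtain \<mu> where \<mu>: "measure_pmf \<mu> = distr M (count_space UNIV) X"
    using countable_distr_pmf[OF \<open>prob_space M\<close> X_rv] by blast
  have prob_X: "measure_pmf.prob \<mu> A = measure M {\<omega> \<in> space M. X \<omega> \<in> A}" for A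
    unfolding \<mu> using X_rv by (subst measure_distr) (auto simp: vimage_def Int_def conj_commute)
  have expect_X: "(\<integral>k. f k \<partial>\<mu>) = (\<integral>\<omega>. f (X \<omega>) \<partial>M)" for f :: "int \<Rightarrow> real"
    unfolding \<mu> by (rule integral_distr[OF X_rv]) simp
  define T where "T = (\<lambda>x. measure_pmf.prob \<mu> {k. x \<le> real_of_int k})"
  have T_M: "T x = measure M {\<omega> \<in> space M. x \<le> real_of_int (X \<omega>)}" for x
    unfolding T_def prob_X by simp
  have T_asymp: "T \<sim>[at_top] (\<lambda>x. L x / x)" using X_tail unfolding T_M[abs_def] .
  obtain A where LA: "\<And>x. A \<le> x \<Longrightarrow> 0 < L x" and
    L: "\<And>c. 0 < c \<Longrightarrow> ((\<lambda>x. L (c * x) / L x) \<longlongrightarrow> 1) at_top"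
    using L_slowly_varying unfolding slowly_varying_def by auto
  have T_pos: "0 < T x" for x
  proof -
    have "\<forall>\<^sub>F x in at_top. 0 < L x / x"
      using eventually_ge_at_top[of A] eventually_gt_at_top[of 0] by eventually_elim (simp add: LA)
    then have "\<forall>\<^sub>F x in at_top. T x \<noteq> 0"
      using asymp_equiv_eventually_zeros[OF T_asymp] by eventually_elim auto
    then obtain z where z: "\<And>y. z \<le> y \<Longrightarrow> T y \<noteq> 0" unfolding eventually_at_top_linorder by auto
    have "T (max x z) \<noteq> 0" by (rule z) simp
    then have "0 < T (max x z)" unfolding T_def by (simp add: zero_less_measure_iff)
    also have "\<dots> \<le> T x" unfolding T_def by (rule measure_pmf.finite_measure_mono) auto
    finally show ?thesis .
  qed
  have T_regular: "((\<lambda>x. T (c * x) / T x) \<longlongrightarrow> 1 / c) at_top" if c: "0 < c" for c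
  proof -
    have cx: "filterlim (\<lambda>x. c * x) at_top at_top"
      by (rule filterlim_tendsto_pos_mult_at_top[OF tendsto_const c filterlim_ident])
    have "(\<lambda>x. T (c * x) / T x) \<sim>[at_top] (\<lambda>x. (L (c * x) / (c * x)) / (L x / x))"
      by (intro asymp_equiv_divide T_asymp asymp_equiv_compose'[OF T_asymp cx])
    moreover have "((\<lambda>x. (L (c * x) / (c * x)) / (L x / x)) \<longlongrightarrow> 1 / c) at_top"
    proof -
      have "((\<lambda>x. L (c * x) / L x * (1 / c)) \<longlongrightarrow> 1 * (1 / c)) at_top"
        by (intro tendsto_intros L c)
      moreover have "\<forall>\<^sub>F x in at_top. L (c * x) / L x * (1 / c) = (L (c * x) / (c * x)) / (L x / x)"
        using eventually_gt_at_top[of 0] by eventually_elim (use c in simp)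
      ultimately show ?thesis by (simp add: tendsto_cong)
    qed
    ultimately show ?thesis by (rule tendsto_asymp_equiv_cong[THEN iffD2])
  qed
  interpret scaled_cauchy_walk \<mu> T a
  proof unfold_locales
    show "-1 \<le> x" if "x \<in> set_pmf \<mu>" for x
    proof (rule ccontr)
      assume "\<not> -1 \<le> x"
      then have "0 < measure_pmf.prob \<mu> {..< -1}" using that by (intro measure_pmf_posI) auto
      then show False using X_ge by (simp add: prob_X)
    qed
    show "T x = measure_pmf.prob \<mu> {k. x \<le> real_of_int k}" for x by (simp add: T_def)
    show "integrable (measure_pmf \<mu>) real_of_int"
      unfolding \<mu> using X_rv X_integrable by (subst integrable_distr_eq) auto
    show "measure_pmf.expectation \<mu> real_of_int = 0" unfolding expect_X by (rule X_centered)
    show "(\<lambda>n. real n * T (a n)) \<longlonglongrightarrow> 1" using a by (simp add: T_M)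
  qed (use T_pos T_regular in auto)
  have path: "pr n A = measure M {\<omega> \<in> space M. A (map (\<lambda>i. Y i \<omega>) [1..<Suc n])}" for n A
  proof -
    have Y: "Y i \<in> measurable M (count_space UNIV)" if "1 \<le> i" for i
      using Y_indep that unfolding M.indep_vars_def2 by auto
    have Z: "(\<lambda>\<omega>. map (\<lambda>i. Y i \<omega>) [1..<Suc n]) \<in> measurable M (count_space UNIV)"
      by (rule measurable_map_list) (auto intro: Y)
    have "measure_pmf (replicate_pmf n \<mu>) = distr M (count_space UNIV) (\<lambda>\<omega>. map (\<lambda>i. Y i \<omega>) [1..<Suc n])"
      by (rule iid_prefix_distr[symmetric, OF \<open>prob_space M\<close> Y_indep]) (simp add: \<mu> Y_distr)
    then show ?thesis
      using measure_distr[OF Z, of "{xs. A xs}"] by (simp add: vimage_def Int_def conj_commute del: upt_Suc)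
  qed
  have zeta: "measure M {\<omega> \<in> space M. enat n < \<zeta> \<omega>} = stay_nonneg n" for n
    unfolding stay_nonneg_def path \<zeta>_def W_def
    by (intro arg_cong[of _ _ "measure M"] Collect_cong conj_cong refl)
      (simp add: less_first_negative_time walk_def[of _ 0] psum_map_walk del: upt_Suc One_nat_def)
  have T1: "measure M {\<omega> \<in> space M. enat n < T\<^sub>1 \<omega>} = stay_neg n" for n
    unfolding stay_neg_def path T\<^sub>1_def W_def
    by (intro arg_cong[of _ _ "measure M"] Collect_cong conj_cong refl)
      (simp add: less_first_nonneg_time psum_map_walk del: upt_Suc One_nat_def)
  have abs_b_eq_drift: "\<forall>\<^sub>F n in sequentially. \<bar>b n\<bar> = drift n"
  proof -
    have "\<forall>\<^sub>F n in sequentially. 1 \<le> a n" by (intro at_a eventually_ge_at_top)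
    with eventually_ge_at_top[of 1] show ?thesis
    proof eventually_elim
      case (elim n)
      have "(\<integral>\<omega>. real_of_int (X \<omega>) * indicator {\<omega>. \<bar>real_of_int (X \<omega>)\<bar> \<le> a n} \<omega> \<partial>M) =
          (\<integral>k. real_of_int k * indicator {k. \<bar>real_of_int k\<bar> \<le> a n} k \<partial>\<mu>)"
        unfolding expect_X by (simp add: indicator_def)
      also have "\<dots> = (\<integral>k. real_of_int (cut (a n) k) \<partial>\<mu>)"
      proof (intro integral_cong_AE)
        have "\<bar>real_of_int k\<bar> \<le> a n \<longleftrightarrow> real_of_int k \<le> a n" if "k \<in> set_pmf \<mu>" for k
        proof -
          have "-1 \<le> real_of_int k" using step_ge[OF that] by linarith
          then show ?thesis using elim by linarith
        qed
        then show "AE k in \<mu>. real_of_int k * indicator {k. \<bar>real_of_int k\<bar> \<le> a n} k = real_of_int (cut (a n) k)"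
          by (auto simp: AE_measure_pmf_iff cut_def indicator_def)
      qed auto
      also have "\<dots> = - tail_mean (a n)" by (rule expectation_cut)
      finally have "b n = - drift n" using b[of n] elim by (simp add: drift_def)
      moreover have "0 \<le> drift n" unfolding drift_def using elim tail_mean_pos[of "a n"] by simp
      ultimately show ?case by simp
    qed
  qed
  have U_Lam: "(\<lambda>n. U n) \<sim>[sequentially] (\<lambda>n. Lam (real n))"
    by (rule asymp_equiv_symI, rule asymp_equivI') (rule Lam_asymp)
  have "(\<lambda>n. stay_nonneg n) \<sim>[sequentially] (\<lambda>n. T (drift n) * U n)"
    by (rule asymp_equivI') (rule stay_nonneg_asymp)
  also have "\<dots> \<sim>[sequentially] (\<lambda>n. L (drift n) / drift n * Lam (real n))"
    by (intro asymp_equiv_mult U_Lam asymp_equiv_compose'[OF T_asymp drift_top])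
  also have "\<dots> \<sim>[sequentially] (\<lambda>n. L \<bar>b n\<bar> / \<bar>b n\<bar> * Lam (real n))"
    by (rule asymp_equiv_refl_ev) (use abs_b_eq_drift in eventually_elim, simp)
  finally have 1: "(\<lambda>n. stay_nonneg n) \<sim>[sequentially] (\<lambda>n. L \<bar>b n\<bar> / \<bar>b n\<bar> * Lam (real n))" .
  have "(\<lambda>n. stay_neg n) \<sim>[sequentially] (\<lambda>n. 1 / U n)"
    by (rule asymp_equivI') (use stay_neg_asymp in simp)
  also have "\<dots> \<sim>[sequentially] (\<lambda>n. 1 / Lam (real n))"
    by (intro asymp_equiv_divide U_Lam asymp_equiv_refl)
  finally have 2: "(\<lambda>n. stay_neg n) \<sim>[sequentially] (\<lambda>n. 1 / Lam (real n))" .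
  have 3: "(\<lambda>n. \<Sum>k=0..n. stay_nonneg k) \<sim>[sequentially] (\<lambda>n. Lam (real n))"
    using U_Lam by (simp add: U_def atMost_atLeast0)
  show ?thesis
    unfolding zeta T1 using Lam_strict_mono Lam_slowly_varying 1 2 3 by blast
qed

end
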